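(* Let $\alpha_{\mathbb S}^*$ be the unique minimiser of $\mathcal L$ over $H_{\mathbb S}$ and let $\alpha^*=a-\theta-\sum_{S\in\mathbb S}\alpha_S^*$. Then for any (measurable) estimator sequence $(\theta_n)$, $$\sup_{I\subset\mathbb R}\ \liminf_{n\to\infty}\ \max_{t\in I}\ \mathbb E_{f_{n^{-1/2}t\alpha^*}}\bigl[n\{\theta_n-\theta(f_{n^{-1/2}t\alpha^*})\}^2\bigr]\ \ge\ \inf_{\alpha_{\mathbb S}\in H_{\mathbb S}}\mathcal L(\alpha_{\mathbb S}),$$ where the supremum is taken over all finite subsets $I$ of $\mathbb R$.
   Context: Setting. Let $d\ge 2$, $[d]=\{1,\dots,d\}$, let $f$ be a probability density on $\mathbb R^d$ and $X\sim f$. For $x\in\mathbb R^d$, $S\subseteq[d]$ write $x_S=(x_j:j\in S)\in\mathbb R^S$ and $f_S$ for the density of $X_S$. Let $\mathbb S\subseteq 2^{[d]}\setminus\{[d]\}$, and for $S\in\mathbb S$ let $r_S:\mathbb R^S\to(0,\infty)$ be a known measurable function with normalised version $\bar r_S=r_S/\int r_Sf_S$, assumed bounded: $\|\bar r_S\|_\infty<\infty$. Functions of $x_S$ are also regarded as functions of $x$. Let $a:\mathbb R^d\to\mathbb R$ be a known measurable function with $\int a^2f<\infty$, and for a density $g$ let $\theta(g)=\int ag$; $\theta=\theta(f)$. Data. For sample sizes $n$ and $n_S\ge 1$ ($S\in\mathbb S$, depending on $n$, with $n_S/n\to\lambda_S\in(0,\infty)$ as $n\to\infty$) we observe mutually independent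 samples: $X_1,\dots,X_n$ i.i.d. with density $f$; and, for each $S\in\mathbb S$, $X_{S,1},\dots,X_{S,n_S}$ for which only the coordinates in $S$ are observed, with $(X_{S,i})_S$ i.i.d. with density $\bar r_Sf_S$. An estimator is a measurable function of the observed data. $\mathbb E_g$ denotes expectation when $f$ is replaced by the density $g$ (so complete data have density $g$ and the data on $S$ have density proportional to $r_Sg_S$, with the same $r_S$). Objective. $L^2=\{\alpha:\mathbb R^d\to\mathbb R:\int\alpha^2f<\infty\}$, $H_S=\{\alpha_S\in L^2:\alpha_S(x)\equiv\alpha_S(x_S),\int\alpha_Sf=0\}$, $H_{\mathbb S}=\prod_{S\in\mathbb S}H_S$, and for $\alpha_{\mathbb S}\in H_{\mathbb S}$ $$\mathcal L(\alpha_{\mathbb S})=\mathrm{Var}\Bigl(a(X)-\sum_{S\in\mathbb S}\alpha_S(X_S)\Bigr)+\sum_{S\in\mathbb S}\mathbb E\Bigl[\frac{\alpha_S(X_S)^2}{\lambda_S\bar r_S(X_S)}\Bigr]\in[0,\infty].$$ It is known that under these assumptions $\mathcal L$ has a unique minimiser over $H_{\mathbb S}$ (up to $f$-a.e. equality). Perturbations. Let $k(u)=1/2+(1+e^{-4u})^{-1}$; for $h\in L^2$, $f_h$ is the probability density with $f_h(x)\propto k(h(x))f(x)$. *)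

theory Defs
  imports "HOL-Probability.Probability"
begin

text \<open>
  A point of \<open>\<real>\<^sup>S\<close>, for a finite set \<open>S\<close> of coordinates, is an extensional function on \<open>S\<close>.
  The full space is the case \<open>S = {1..d}\<close>, and the subvector \<open>x\<^sub>S\<close> is \<open>restrict x S\<close>. For
  \<open>S = {}\<close> the space is a single point of mass 1.
\<close>

type_synonym point = "nat \<Rightarrow> real"

abbreviation Leb :: "nat set \<Rightarrow> point measure" where
  "Leb S \<equiv> (\<Pi>\<^sub>M j\<in>S. lborel)"

definition prob_density :: "nat \<Rightarrow> (point \<Rightarrow> real) \<Rightarrow> bool" where
  "prob_density d g \<longleftrightarrow>
     g \<in> borel_measurable (Leb {1..d}) \<and> (\<forall>x\<in>space (Leb {1..d}). 0 \<le> g x) \<and>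
     (\<integral>\<^sup>+x. ennreal (g x) \<partial>Leb {1..d}) = 1"

definition law :: "nat \<Rightarrow> (point \<Rightarrow> real) \<Rightarrow> point measure" where
  "law d g = density (Leb {1..d}) (\<lambda>x. ennreal (g x))"

text \<open>
  The marginal density \<open>g\<^sub>S\<close>, obtained by integrating out the coordinates outside \<open>S\<close>. On the
  Lebesgue-null set where that integral diverges, the Bochner integral gives the value 0.
\<close>

definition marginal :: "nat \<Rightarrow> nat set \<Rightarrow> (point \<Rightarrow> real) \<Rightarrow> point \<Rightarrow> real" where
  "marginal d S g y =
     (\<integral>z. g (merge S ({1..d} - S) (y, z)) \<partial>Leb ({1..d} - S))"

definition normalised ::
  "nat \<Rightarrow> (nat set \<Rightarrow> point \<Rightarrow> real) \<Rightarrow> nat set \<Rightarrow> (point \<Rightarrow> real) \<Rightarrow> point \<Rightarrow> real" where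
  "normalised d r S g y = r S y / (\<integral>z. r S z * marginal d S g z \<partial>Leb S)"

definition partial_law ::
  "nat \<Rightarrow> (nat set \<Rightarrow> point \<Rightarrow> real) \<Rightarrow> nat set \<Rightarrow> (point \<Rightarrow> real) \<Rightarrow> point measure" where
  "partial_law d r S g =
     density (Leb S) (\<lambda>y. ennreal (normalised d r S g y * marginal d S g y))"

definition theta :: "nat \<Rightarrow> (point \<Rightarrow> real) \<Rightarrow> (point \<Rightarrow> real) \<Rightarrow> real" where
  "theta d a g = (\<integral>x. a x * g x \<partial>Leb {1..d})"

text \<open>
  A data set is a pair: the first component maps \<open>i\<close> to \<open>X\<^sub>i\<close>, the second maps \<open>S\<close> and \<open>i\<close> to the
  observed coordinates of \<open>X\<^bsub>S,i\<^esub>\<close>. The argument \<open>m\<close> gives the sample sizes \<open>n\<^sub>S\<close>.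
\<close>

type_synonym data = "(nat \<Rightarrow> point) \<times> (nat set \<Rightarrow> nat \<Rightarrow> point)"

definition data_space :: "nat \<Rightarrow> nat set set \<Rightarrow> nat \<Rightarrow> (nat set \<Rightarrow> nat) \<Rightarrow> data measure" where
  "data_space d SS n m =
     (\<Pi>\<^sub>M i\<in>{1..n}. Leb {1..d}) \<Otimes>\<^sub>M (\<Pi>\<^sub>M S\<in>SS. \<Pi>\<^sub>M i\<in>{1..m S}. Leb S)"

definition data_law ::
  "nat \<Rightarrow> nat set set \<Rightarrow> (nat set \<Rightarrow> point \<Rightarrow> real) \<Rightarrow> nat \<Rightarrow> (nat set \<Rightarrow> nat) \<Rightarrow>
   (point \<Rightarrow> real) \<Rightarrow> data measure" where
  "data_law d SS r n m g =
     (\<Pi>\<^sub>M i\<in>{1..n}. law d g) \<Otimes>\<^sub>M (\<Pi>\<^sub>M S\<in>SS. \<Pi>\<^sub>M i\<in>{1..m S}. partial_law d r S g)"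

definition L2 :: "nat \<Rightarrow> (point \<Rightarrow> real) \<Rightarrow> (point \<Rightarrow> real) set" where
  "L2 d f = {\<alpha> \<in> borel_measurable (Leb {1..d}). integrable (Leb {1..d}) (\<lambda>x. (\<alpha> x)\<^sup>2 * f x)}"

definition H :: "nat \<Rightarrow> (point \<Rightarrow> real) \<Rightarrow> nat set \<Rightarrow> (point \<Rightarrow> real) set" where
  "H d f S = {\<alpha> \<in> L2 d f.
     (\<exists>\<beta>\<in>borel_measurable (Leb S). \<forall>x\<in>space (Leb {1..d}). \<alpha> x = \<beta> (restrict x S)) \<and>
     (\<integral>x. \<alpha> x * f x \<partial>Leb {1..d}) = 0}"

definition Lobj ::
  "nat \<Rightarrow> nat set set \<Rightarrow> (point \<Rightarrow> real) \<Rightarrow> (nat set \<Rightarrow> point \<Rightarrow> real) \<Rightarrow> (nat set \<Rightarrow> real) \<Rightarrow>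
   (point \<Rightarrow> real) \<Rightarrow> (nat set \<Rightarrow> point \<Rightarrow> real) \<Rightarrow> ennreal" where
  "Lobj d SS f r lam a \<alpha> =
     ennreal (prob_space.variance (law d f) (\<lambda>x. a x - (\<Sum>S\<in>SS. \<alpha> S x))) +
     (\<Sum>S\<in>SS. \<integral>\<^sup>+x. ennreal ((\<alpha> S x)\<^sup>2 / (lam S * normalised d r S f (restrict x S))) \<partial>law d f)"

definition kfun :: "real \<Rightarrow> real" where
  "kfun u = 1 / 2 + 1 / (1 + exp (- 4 * u))"

definition perturbed :: "nat \<Rightarrow> (point \<Rightarrow> real) \<Rightarrow> (point \<Rightarrow> real) \<Rightarrow> point \<Rightarrow> real" where
  "perturbed d f h x = kfun (h x) * f x / (\<integral>z. kfun (h z) * f z \<partial>Leb {1..d})"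

definition scaled_risk ::
  "nat \<Rightarrow> nat set set \<Rightarrow> (nat set \<Rightarrow> point \<Rightarrow> real) \<Rightarrow> (point \<Rightarrow> real) \<Rightarrow> nat \<Rightarrow>
   (nat set \<Rightarrow> nat) \<Rightarrow> (data \<Rightarrow> real) \<Rightarrow> (point \<Rightarrow> real) \<Rightarrow> ennreal" where
  "scaled_risk d SS r a n m est g =
     (\<integral>\<^sup>+\<omega>. ennreal (real n * (est \<omega> - theta d a g)\<^sup>2) \<partial>data_law d SS r n m g)"

end

theory Submission
  imports Defs "HOL-Real_Asymp.Real_Asymp"
begin

text \<open>
  The maximal risk over a finite set of local parameters is at least the average risk over it, so
  it suffices to bound a Bayes risk from below. The prior is uniform on a grid
  \<open>0, \<delta>, \<dots>, (m + 1)\<delta>\<close>, and the bound is a discrete form of the van Trees (Bayesian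
  Cramer-Rao) inequality in which the score is replaced by central differences of square roots
  \<open>q\<^sub>j\<close> of likelihoods (\<open>grid_van_trees\<close>). The inequality involves the data only through the
  affinities \<open>\<integral> q\<^sub>i q\<^sub>j\<close> and the target only through its increments, so it remains to find
  the limits of these two quantities.

  Affinities multiply over independent observations. For a single observation,
  \<open>n (1 - affinity)\<close> tends to \<open>(s - t)\<^sup>2 / 8\<close> times the variance of the score
  (\<open>affinity_limit\<close>), so the affinity of the whole data set tends to
  \<open>exp (- (s - t)\<^sup>2 I / 8)\<close>. Here \<open>I\<close> is \<open>E \<alpha>\<^sup>2\<close> plus, for each \<open>S\<close>, \<open>\<lambda>\<^sub>S\<close> times the
  variance of \<open>E(\<alpha> | X\<^sub>S)\<close> under the biased law of the sample \<open>S\<close>: marginalising the tilt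
  \<open>k (h)\<close> leaves its conditional mean as the tilt of the marginal density
  (\<open>sqrt_density_partial_law\<close>). The scaled target has the derivative \<open>E(a \<alpha>)\<close>
  (\<open>theta_local_limit\<close>).

  The minimiser enters through its first-order condition: up to a constant,
  \<open>E(\<alpha> | X\<^sub>S)\<close> equals \<open>\<alpha>\<^sub>S / (\<lambda>\<^sub>S rbar\<^sub>S)\<close>. Hence the sample \<open>S\<close> carries exactly the
  information that the objective charges for \<open>\<alpha>\<^sub>S\<close> (\<open>partial_information\<close>), and both \<open>I\<close> and
  \<open>E(a \<alpha>)\<close> are the minimum of the objective. With this, the grid inequality tends to
  \<open>2 I exp (- \<delta>\<^sup>2 I / 8) - (2 - 2 exp (- \<delta>\<^sup>2 I / 2)) / \<delta>\<^sup>2\<close> as \<open>n\<close> and then \<open>m\<close> grow, and this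
  tends to \<open>2 I - I = I\<close> as \<open>\<delta>\<close> tends to 0.
\<close>

section \<open>A discrete van Trees inequality\<close>

text \<open>
  Summation by parts on the grid. The roots are continued by 0 beyond both ends, so no boundary
  terms arise.
\<close>

lemma sum_telescoping_by_parts:
  fixes e q :: "nat \<Rightarrow> real"
  shows "(\<Sum>j\<le>Suc m. e j * q j * ((if j \<le> m then q (Suc j) else 0) - (if 0 < j then q (j - 1) else 0)))
       = (\<Sum>j\<le>m. (e j - e (Suc j)) * (q j * q (Suc j)))"
proof -
  have 1: "(\<Sum>j\<le>Suc m. e j * q j * (if j \<le> m then q (Suc j) else 0)) = (\<Sum>j\<le>m. e j * q j * q (Suc j))"
    by (simp add: sum.atMost_Suc)
  have 2: "(\<Sum>j\<le>Suc m. e j * q j * (if 0 < j then q (j - 1) else 0)) = (\<Sum>j\<le>m. e (Suc j) * q (Suc j) * q j)"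
    by (subst sum.atMost_Suc_shift) simp
  show ?thesis
    unfolding right_diff_distrib sum_subtractf 1 2
    by (simp add: sum_subtractf[symmetric] algebra_simps)
qed

lemma sum_central_difference_squares:
  fixes q :: "nat \<Rightarrow> real"
  shows "(\<Sum>j\<le>Suc m. ((if j \<le> m then q (Suc j) else 0) - (if 0 < j then q (j - 1) else 0))\<^sup>2)
       = (q (Suc 0))\<^sup>2 + (q m)\<^sup>2 + (\<Sum>j<m. (q (Suc (Suc j)) - q j)\<^sup>2)"
proof (cases m)
  case (Suc k)
  show ?thesis unfolding Suc
    by (subst sum.atMost_Suc_shift, subst sum.atMost_Suc)
       (auto simp: lessThan_Suc_atMost intro!: sum.cong)
qed simp

text \<open>
  The sum of the squares of \<open>c (T - \<psi>\<^sub>j) q\<^sub>j - l D\<^sub>j\<close>, where \<open>D\<^sub>j\<close> is the central difference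
  \<open>q\<^bsub>j+1\<^esub> - q\<^bsub>j-1\<^esub>\<close>, is nonnegative. In the cross term summation by parts removes \<open>T\<close>, so
  that the lower bound is free of the estimator, and hence integrable whatever the estimator is.
\<close>

lemma grid_van_trees_pointwise:
  fixes q \<psi> :: "nat \<Rightarrow> real" and T c l :: real
  shows "2 * l * c * (\<Sum>j\<le>m. (\<psi> (Suc j) - \<psi> j) * (q j * q (Suc j)))
       - l\<^sup>2 * ((q (Suc 0))\<^sup>2 + (q m)\<^sup>2 + (\<Sum>j<m. (q (Suc (Suc j)) - q j)\<^sup>2))
       \<le> (\<Sum>j\<le>Suc m. (q j)\<^sup>2 * (c\<^sup>2 * (T - \<psi> j)\<^sup>2))"
proof -
  define D where "D j = (if j \<le> m then q (Suc j) else 0) - (if 0 < j then q (j - 1) else 0)" for j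
  have "0 \<le> (\<Sum>j\<le>Suc m. (c * (T - \<psi> j) * q j - l * D j)\<^sup>2)"
    by (intro sum_nonneg) simp
  also have "\<dots> = (\<Sum>j\<le>Suc m. (q j)\<^sup>2 * (c\<^sup>2 * (T - \<psi> j)\<^sup>2)) - 2 * l * c * (\<Sum>j\<le>Suc m. (T - \<psi> j) * q j * D j)
      + l\<^sup>2 * (\<Sum>j\<le>Suc m. (D j)\<^sup>2)"
    unfolding sum_distrib_left sum_subtractf[symmetric] sum.distrib[symmetric]
    by (intro sum.cong refl) (simp add: power2_eq_square algebra_simps)
  finally show ?thesis
    unfolding D_def sum_telescoping_by_parts[of "\<lambda>j. T - \<psi> j"] sum_central_difference_squares
    by simp
qed

lemma integrable_mult_of_squares:
  fixes u v :: "'a \<Rightarrow> real"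
  assumes [measurable]: "u \<in> borel_measurable M" "v \<in> borel_measurable M"
    and "integrable M (\<lambda>x. (u x)\<^sup>2)" "integrable M (\<lambda>x. (v x)\<^sup>2)"
  shows "integrable M (\<lambda>x. u x * v x)"
proof (rule Bochner_Integration.integrable_bound[OF Bochner_Integration.integrable_add[OF assms(3,4)]])
  have "\<bar>a * b\<bar> \<le> a\<^sup>2 + b\<^sup>2" for a b :: real
  proof -
    have "2 * \<bar>a * b\<bar> \<le> a\<^sup>2 + b\<^sup>2"
      using sum_squares_bound[of "\<bar>a\<bar>" "\<bar>b\<bar>"] by (simp add: abs_mult)
    then show ?thesis by linarith
  qed
  then show "AE x in M. norm (u x * v x) \<le> norm ((u x)\<^sup>2 + (v x)\<^sup>2)" by auto
qed simp

text \<open>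
  The Bayes risk under the uniform prior is bounded through affinities of neighbouring
  likelihoods. The constant \<open>2\<close> is the contribution of the two ends of the grid, where the central
  difference consists of a single root. The multiplier \<open>l\<close> is free; one over the grid spacing is
  asymptotically the best choice for a fine grid.
\<close>

lemma grid_van_trees:
  fixes q :: "nat \<Rightarrow> 'a \<Rightarrow> real" and \<psi> :: "nat \<Rightarrow> real" and T :: "'a \<Rightarrow> real" and c l :: real
  assumes q[measurable]: "\<And>j. q j \<in> borel_measurable M"
    and T[measurable]: "T \<in> borel_measurable M"
    and int: "\<And>j. integrable M (\<lambda>x. (q j x)\<^sup>2)"
    and one: "\<And>j. (\<integral>x. (q j x)\<^sup>2 \<partial>M) = 1"
  defines "B \<equiv> \<lambda>j k. \<integral>x. q j x * q k x \<partial>M"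
  shows "ennreal ((2 * l * c * (\<Sum>j\<le>m. (\<psi> (Suc j) - \<psi> j) * B j (Suc j))
            - l\<^sup>2 * (2 + (\<Sum>j<m. 2 - 2 * B j (Suc (Suc j))))) / (real m + 2))
       \<le> Max ((\<lambda>j. \<integral>\<^sup>+x. ennreal (c\<^sup>2 * (T x - \<psi> j)\<^sup>2) \<partial>density M (\<lambda>x. ennreal ((q j x)\<^sup>2))) ` {..Suc m})"
    (is "ennreal (?X / _) \<le> Max (?R ` _)")
proof -
  define low where "low x = 2 * l * c * (\<Sum>j\<le>m. (\<psi> (Suc j) - \<psi> j) * (q j x * q (Suc j) x))
       - l\<^sup>2 * ((q (Suc 0) x)\<^sup>2 + (q m x)\<^sup>2 + (\<Sum>j<m. (q (Suc (Suc j)) x - q j x)\<^sup>2))" for x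
  note prod_int[simp] = integrable_mult_of_squares[OF q q int int]
  have sq: "(\<lambda>x. (q i x - q j x)\<^sup>2) = (\<lambda>x. (q i x)\<^sup>2 + (q j x)\<^sup>2 - 2 * (q j x * q i x))" for i j
    by (auto simp: power2_eq_square algebra_simps)
  have sq_int[simp]: "integrable M (\<lambda>x. (q i x - q j x)\<^sup>2)" for i j
    unfolding sq using int by simp
  have sq_val: "(\<integral>x. (q i x - q j x)\<^sup>2 \<partial>M) = 2 - 2 * B j i" for i j
    unfolding sq B_def using int by (simp add: one)
  have low_int: "integrable M low" and low_val: "integral\<^sup>L M low = ?X"
    unfolding low_def using int by (simp_all add: sq_val one, simp add: B_def)
  have "ennreal ?X \<le> ennreal (\<integral>x. max 0 (low x) \<partial>M)"
    unfolding low_val[symmetric] using low_int by (intro ennreal_leI integral_mono) auto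
  also have "\<dots> = (\<integral>\<^sup>+x. ennreal (max 0 (low x)) \<partial>M)"
    using low_int by (intro nn_integral_eq_integral[symmetric]) auto
  also have "\<dots> \<le> (\<integral>\<^sup>+x. (\<Sum>j\<le>Suc m. ennreal ((q j x)\<^sup>2) * ennreal (c\<^sup>2 * (T x - \<psi> j)\<^sup>2)) \<partial>M)"
  proof (rule nn_integral_mono)
    fix x
    have "low x \<le> (\<Sum>j\<le>Suc m. (q j x)\<^sup>2 * (c\<^sup>2 * (T x - \<psi> j)\<^sup>2))"
      unfolding low_def by (rule grid_van_trees_pointwise)
    then have "max 0 (low x) \<le> (\<Sum>j\<le>Suc m. (q j x)\<^sup>2 * (c\<^sup>2 * (T x - \<psi> j)\<^sup>2))"
      by (intro max.boundedI sum_nonneg) auto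
    then have "ennreal (max 0 (low x)) \<le> ennreal (\<Sum>j\<le>Suc m. (q j x)\<^sup>2 * (c\<^sup>2 * (T x - \<psi> j)\<^sup>2))"
      by (rule ennreal_leI)
    also have "\<dots> = (\<Sum>j\<le>Suc m. ennreal ((q j x)\<^sup>2 * (c\<^sup>2 * (T x - \<psi> j)\<^sup>2)))"
      by (rule sum_ennreal[symmetric]) auto
    also have "\<dots> = (\<Sum>j\<le>Suc m. ennreal ((q j x)\<^sup>2) * ennreal (c\<^sup>2 * (T x - \<psi> j)\<^sup>2))"
      by (intro sum.cong refl ennreal_mult) auto
    finally show "ennreal (max 0 (low x)) \<le> (\<Sum>j\<le>Suc m. ennreal ((q j x)\<^sup>2) * ennreal (c\<^sup>2 * (T x - \<psi> j)\<^sup>2))" .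
  qed
  also have "\<dots> = (\<Sum>j\<le>Suc m. ?R j)"
    by (subst nn_integral_sum) (auto simp: nn_integral_density)
  also have "\<dots> \<le> of_nat (card {..Suc m}) * Max (?R ` {..Suc m})"
    by (intro sum_bounded_above Max_ge) auto
  finally have *: "ennreal ?X \<le> of_nat (card {..Suc m}) * Max (?R ` {..Suc m})" .
  show ?thesis
  proof (cases "Max (?R ` {..Suc m})")
    case (real \<rho>)
    have "ennreal ?X \<le> ennreal ((real m + 2) * \<rho>)"
      using * real by (simp add: ennreal_mult ennreal_of_nat_eq_real_of_nat algebra_simps)
    then have "?X \<le> (real m + 2) * \<rho>"
      using real by (simp add: ennreal_le_iff)
    then show ?thesis
      using real by (auto intro!: ennreal_leI simp: divide_simps mult.commute)
  qed simp
qed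

section \<open>The tilting function and the limit of affinities\<close>

lemma kfun_bounds: "1 / 2 \<le> kfun u" "kfun u \<le> 3 / 2"
  by (simp_all add: kfun_def divide_simps add_pos_pos less_imp_le)

lemma kfun_pos: "0 < kfun u" using kfun_bounds(1)[of u] by linarith

lemma kfun_zero[simp]: "kfun 0 = 1" by (simp add: kfun_def)

lemma kfun_measurable[measurable]: "kfun \<in> borel_measurable borel"
  unfolding kfun_def[abs_def] by measurable

lemma kfun_deriv: "(kfun has_real_derivative (4 * exp (- 4 * u) / (1 + exp (- 4 * u))\<^sup>2)) (at u)"
proof -
  have "1 + exp (- 4 * u) \<noteq> 0" by (metis add_pos_pos exp_gt_zero less_numeral_extra(1) less_numeral_extra(3))
  then show ?thesis unfolding kfun_def[abs_def]
    by (auto intro!: derivative_eq_intros simp: power2_eq_square)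
qed

text \<open>
  The derivative is \<open>4 e / (1 + e)\<^sup>2\<close> with \<open>e = exp (- 4 u)\<close>, which is at most 1 by the inequality
  of the means.
\<close>

lemma kfun_lipschitz: "\<bar>kfun u - 1\<bar> \<le> \<bar>u\<bar>"
proof -
  have b: "norm (4 * exp (- 4 * v) / (1 + exp (- 4 * v))\<^sup>2) \<le> 1" for v :: real
  proof -
    have "4 * exp (- 4 * v) \<le> (1 + exp (- 4 * v))\<^sup>2"
      using sum_squares_bound[of 1 "exp (- 4 * v)"] by (simp add: power2_eq_square algebra_simps)
    moreover have "0 < (1 + exp (- 4 * v))\<^sup>2"
      by (intro zero_less_power add_pos_pos) auto
    ultimately show ?thesis by (simp add: divide_simps)
  qed
  have "norm (kfun u - kfun 0) \<le> 1 * norm (u - 0)"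
    by (rule field_differentiable_bound[OF convex_UNIV _ b], rule DERIV_subset[OF kfun_deriv]) simp_all
  then show ?thesis by simp
qed

text \<open>
  \<open>k(0) = k'(0) = 1\<close>, which makes \<open>h\<close> the score of the path \<open>t \<mapsto> f\<^bsub>t h\<^esub>\<close>.
\<close>

lemma kfun_local_linearisation:
  "(\<lambda>n. sqrt (real n) * (kfun (real n powr (- 1 / 2) * v) - 1)) \<longlonglongrightarrow> v"
proof -
  consider "v = 0" | "v > 0" | "v < 0" by linarith
  then show ?thesis unfolding kfun_def
    by cases (simp_all, real_asymp+)
qed

lemma kfun_local_bound:
  "\<bar>sqrt (real n) * (kfun (real n powr (- 1 / 2) * v) - 1)\<bar> \<le> \<bar>v\<bar>"
proof -
  have "\<bar>sqrt (real n) * (kfun (real n powr (- 1 / 2) * v) - 1)\<bar> \<le> sqrt (real n) * \<bar>real n powr (- 1 / 2) * v\<bar>"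
    using mult_left_mono[OF kfun_lipschitz, of "sqrt (real n)" "real n powr (- 1 / 2) * v"]
    by (simp add: abs_mult[of "sqrt (real n)"])
  also have "\<dots> \<le> \<bar>v\<bar>"
    by (cases "n = 0") (auto simp: abs_mult powr_minus powr_half_sqrt divide_simps)
  finally show ?thesis .
qed

text \<open>
  Turns the limit for one observation into the limit for a sample whose size \<open>m n\<close> is
  proportional to \<open>n\<close>.
\<close>

lemma power_one_minus_tendsto_exp:
  fixes b :: "nat \<Rightarrow> real" and m :: "nat \<Rightarrow> nat"
  assumes b: "(\<lambda>n. real n * b n) \<longlonglongrightarrow> c" and m: "(\<lambda>n. real (m n) / real n) \<longlonglongrightarrow> lam"
  shows "(\<lambda>n. (1 - b n) ^ m n) \<longlonglongrightarrow> exp (- (lam * c))"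
proof -
  have ev: "eventually (\<lambda>n. n > (0::nat)) sequentially" by (rule eventually_gt_at_top)
  have b0: "b \<longlonglongrightarrow> 0"
  proof (rule Lim_transform_eventually)
    show "(\<lambda>n. (real n * b n) * (1 / real n)) \<longlonglongrightarrow> 0"
      using tendsto_mult[OF b lim_1_over_n] by simp
    show "\<forall>\<^sub>F n in sequentially. real n * b n * (1 / real n) = b n"
      using ev by eventually_elim simp
  qed
  have mb: "(\<lambda>n. real (m n) * b n) \<longlonglongrightarrow> lam * c"
  proof (rule Lim_transform_eventually[OF tendsto_mult[OF m b]])
    show "\<forall>\<^sub>F n in sequentially. real (m n) / real n * (real n * b n) = real (m n) * b n"
      using ev by eventually_elim simp
  qed
  have small: "\<forall>\<^sub>F n in sequentially. \<bar>b n\<bar> < 1 / 2"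
    using order_tendstoD(2)[OF tendsto_rabs[OF b0], of "1/2"] by simp
  have rem: "(\<lambda>n. real (m n) * (ln (1 - b n) + b n)) \<longlonglongrightarrow> 0"
  proof (rule Lim_null_comparison)
    show "(\<lambda>n. 2 * \<bar>real (m n) * b n\<bar> * \<bar>b n\<bar>) \<longlonglongrightarrow> 0"
      using tendsto_mult[OF tendsto_mult[OF tendsto_const[of 2] tendsto_rabs[OF mb]] tendsto_rabs[OF b0]] by simp
    show "\<forall>\<^sub>F n in sequentially. norm (real (m n) * (ln (1 - b n) + b n)) \<le> 2 * \<bar>real (m n) * b n\<bar> * \<bar>b n\<bar>"
      using small
    proof eventually_elim
      case (elim n)
      have "\<bar>ln (1 - b n) + b n\<bar> \<le> 2 * (b n)\<^sup>2"
        using abs_ln_one_plus_x_minus_x_bound[of "- b n"] elim by simp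
      then have "real (m n) * \<bar>ln (1 - b n) + b n\<bar> \<le> real (m n) * (2 * (b n)\<^sup>2)"
        by (rule mult_left_mono) simp
      then show ?case by (simp add: abs_mult power2_eq_square mult_ac)
    qed
  qed
  have "(\<lambda>n. exp (real (m n) * (ln (1 - b n) + b n) - real (m n) * b n)) \<longlonglongrightarrow> exp (- (lam * c))"
    using tendsto_exp[OF tendsto_diff[OF rem mb]] by simp
  then show ?thesis
  proof (rule Lim_transform_eventually)
    show "\<forall>\<^sub>F n in sequentially. exp (real (m n) * (ln (1 - b n) + b n) - real (m n) * b n) = (1 - b n) ^ m n"
      using small
    proof eventually_elim
      case (elim n)
      have "real (m n) * (ln (1 - b n) + b n) - real (m n) * b n = real (m n) * ln (1 - b n)"
        by (simp add: algebra_simps)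
      then show ?case using elim by (simp add: exp_of_nat_mult)
    qed
  qed
qed

lemma tendsto_of_scaled:
  fixes z :: "nat \<Rightarrow> real"
  assumes "(\<lambda>n. sqrt (real n) * (z n - 1)) \<longlonglongrightarrow> w"
  shows "z \<longlonglongrightarrow> 1"
proof -
  have "(\<lambda>n. 1 / sqrt (real n)) \<longlonglongrightarrow> 0" by real_asymp
  then have "(\<lambda>n. (sqrt (real n) * (z n - 1)) * (1 / sqrt (real n))) \<longlonglongrightarrow> 0"
    using tendsto_mult[OF assms] by fastforce
  then have "(\<lambda>n. z n - 1) \<longlonglongrightarrow> 0"
    by (rule Lim_transform_eventually) (use eventually_gt_at_top[of "0::nat"] in eventually_elim, simp)
  then show ?thesis by (simp add: LIM_zero_iff)
qed

text \<open>
  \<open>\<surd>x - \<surd>y = (x - y) / (\<surd>x + \<surd>y)\<close>, and the denominator tends to 2.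
\<close>

lemma tendsto_scaled_sqrt_diff:
  fixes x y :: "nat \<Rightarrow> real"
  assumes x: "(\<lambda>n. sqrt (real n) * (x n - 1)) \<longlonglongrightarrow> u" and y: "(\<lambda>n. sqrt (real n) * (y n - 1)) \<longlonglongrightarrow> v"
    and pos: "\<And>n. 0 < x n" "\<And>n. 0 < y n"
  shows "(\<lambda>n. real n * (sqrt (x n) - sqrt (y n))\<^sup>2) \<longlonglongrightarrow> (u - v)\<^sup>2 / 4"
proof -
  have "(\<lambda>n. (sqrt (real n) * (x n - 1) - sqrt (real n) * (y n - 1))\<^sup>2 / (sqrt (x n) + sqrt (y n))\<^sup>2)
      \<longlonglongrightarrow> (u - v)\<^sup>2 / (sqrt 1 + sqrt 1)\<^sup>2"
    by (intro tendsto_intros x y tendsto_of_scaled[OF x] tendsto_of_scaled[OF y]) simp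
  also have "(\<lambda>n. (sqrt (real n) * (x n - 1) - sqrt (real n) * (y n - 1))\<^sup>2 / (sqrt (x n) + sqrt (y n))\<^sup>2)
     = (\<lambda>n. real n * (sqrt (x n) - sqrt (y n))\<^sup>2)"
  proof
    fix n
    have "x n - y n = (sqrt (x n) - sqrt (y n)) * (sqrt (x n) + sqrt (y n))"
      using pos[of n] by (simp add: algebra_simps)
    then have "(sqrt (real n) * (x n - 1) - sqrt (real n) * (y n - 1))\<^sup>2
       = real n * (sqrt (x n) - sqrt (y n))\<^sup>2 * (sqrt (x n) + sqrt (y n))\<^sup>2"
      by (simp add: right_diff_distrib[symmetric] power_mult_distrib)
    moreover have "sqrt (x n) + sqrt (y n) > 0" using pos[of n] by (simp add: add_pos_pos)
    ultimately show "(sqrt (real n) * (x n - 1) - sqrt (real n) * (y n - 1))\<^sup>2 / (sqrt (x n) + sqrt (y n))\<^sup>2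
      = real n * (sqrt (x n) - sqrt (y n))\<^sup>2" by simp
  qed
  finally show ?thesis by simp
qed

text \<open>
  The domination that accompanies \<open>tendsto_scaled_sqrt_diff\<close>: tilts bounded below keep the
  denominator \<open>\<surd>x + \<surd>y\<close> away from 0.
\<close>

lemma scaled_sqrt_diff_le:
  fixes x y g :: real
  assumes "1 / 2 \<le> x" "1 / 2 \<le> y" and "\<bar>c * (x - 1)\<bar> \<le> g" "\<bar>c * (y - 1)\<bar> \<le> g"
  shows "(c * (sqrt x - sqrt y))\<^sup>2 \<le> 4 * g\<^sup>2"
proof -
  have "1 / 2 \<le> sqrt x" "1 / 2 \<le> sqrt y"
    by (rule real_le_rsqrt, use assms in \<open>simp add: power2_eq_square\<close>)+
  then have *: "1 \<le> sqrt x + sqrt y" by simp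
  have "c * (x - 1) - c * (y - 1) = (c * (sqrt x - sqrt y)) * (sqrt x + sqrt y)"
    using assms by (simp add: algebra_simps)
  then have "\<bar>c * (sqrt x - sqrt y)\<bar> * (sqrt x + sqrt y) = \<bar>c * (x - 1) - c * (y - 1)\<bar>"
    using * by (simp add: abs_mult)
  then have "\<bar>c * (sqrt x - sqrt y)\<bar> * (sqrt x + sqrt y) \<le> 2 * g"
    using assms(3,4) by linarith
  moreover have "\<bar>c * (sqrt x - sqrt y)\<bar> * 1 \<le> \<bar>c * (sqrt x - sqrt y)\<bar> * (sqrt x + sqrt y)"
    using * by (intro mult_left_mono) auto
  ultimately have "\<bar>c * (sqrt x - sqrt y)\<bar> \<le> 2 * g" by simp
  then have "\<bar>c * (sqrt x - sqrt y)\<bar>\<^sup>2 \<le> (2 * g)\<^sup>2" by (rule power_mono) simp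
  then show ?thesis by simp
qed

text \<open>
  The affinity of two densities proportional to \<open>x\<close> and \<open>y\<close> is governed by two squared
  differences of roots, since \<open>2 E(\<surd>x \<surd>y) = E x + E y - E (\<surd>x - \<surd>y)\<^sup>2\<close> and likewise for the
  normalising factor \<open>\<surd>(E x) \<surd>(E y)\<close>. By dominated convergence the first difference contributes
  \<open>E A\<^sup>2\<close>; the second one, coming from the normalisation, subtracts \<open>(E A)\<^sup>2\<close>.
\<close>

lemma affinity_limit:
  fixes x y :: "nat \<Rightarrow> 'a \<Rightarrow> real" and A G :: "'a \<Rightarrow> real"
  assumes M: "prob_space M"
    and [measurable]: "\<And>n. x n \<in> borel_measurable M" "\<And>n. y n \<in> borel_measurable M"
      "A \<in> borel_measurable M" "G \<in> borel_measurable M"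
    and bx: "\<And>n. AE \<omega> in M. 1 / 2 \<le> x n \<omega> \<and> x n \<omega> \<le> 3 / 2"
    and bby: "\<And>n. AE \<omega> in M. 1 / 2 \<le> y n \<omega> \<and> y n \<omega> \<le> 3 / 2"
    and lx: "AE \<omega> in M. (\<lambda>n. sqrt (real n) * (x n \<omega> - 1)) \<longlonglongrightarrow> s * A \<omega>"
    and ly: "AE \<omega> in M. (\<lambda>n. sqrt (real n) * (y n \<omega> - 1)) \<longlonglongrightarrow> t * A \<omega>"
    and dx: "\<And>n. AE \<omega> in M. \<bar>sqrt (real n) * (x n \<omega> - 1)\<bar> \<le> G \<omega>"
    and dy: "\<And>n. AE \<omega> in M. \<bar>sqrt (real n) * (y n \<omega> - 1)\<bar> \<le> G \<omega>"
    and A2: "integrable M (\<lambda>\<omega>. (A \<omega>)\<^sup>2)" and G2: "integrable M (\<lambda>\<omega>. (G \<omega>)\<^sup>2)"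
  shows "(\<lambda>n. real n * (1 - (\<integral>\<omega>. sqrt (x n \<omega> / integral\<^sup>L M (x n)) * sqrt (y n \<omega> / integral\<^sup>L M (y n)) \<partial>M)))
      \<longlonglongrightarrow> (s - t)\<^sup>2 * ((\<integral>\<omega>. (A \<omega>)\<^sup>2 \<partial>M) - (\<integral>\<omega>. A \<omega> \<partial>M)\<^sup>2) / 8"
proof -
  interpret prob_space M by fact
  have G1: "integrable M G" and A1: "integrable M A"
    using square_integrable_imp_integrable[of G] square_integrable_imp_integrable[of A] G2 A2 by simp_all
  have means: "integrable M (z n)" "1 / 2 \<le> integral\<^sup>L M (z n)"
    "(\<lambda>n. sqrt (real n) * (integral\<^sup>L M (z n) - 1)) \<longlonglongrightarrow> w * integral\<^sup>L M A"
    if [measurable]: "\<And>n. z n \<in> borel_measurable M"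
      and bz: "\<And>n. AE \<omega> in M. 1 / 2 \<le> z n \<omega> \<and> z n \<omega> \<le> 3 / 2"
      and lz: "AE \<omega> in M. (\<lambda>n. sqrt (real n) * (z n \<omega> - 1)) \<longlonglongrightarrow> w * A \<omega>"
      and dz: "\<And>n. AE \<omega> in M. \<bar>sqrt (real n) * (z n \<omega> - 1)\<bar> \<le> G \<omega>"
    for z :: "nat \<Rightarrow> 'a \<Rightarrow> real" and w n
  proof -
    show int: "integrable M (z n)" for n
      by (rule integrable_const_bound[of _ "3/2"], use bz[of n] in eventually_elim) auto
    have "integral\<^sup>L M (\<lambda>_. 1 / 2) \<le> integral\<^sup>L M (z n)"
      by (rule integral_mono_AE[OF _ int], simp, use bz[of n] in eventually_elim) auto
    then show "1 / 2 \<le> integral\<^sup>L M (z n)" by (simp add: prob_space)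
    have "(\<lambda>n. \<integral>\<omega>. sqrt (real n) * (z n \<omega> - 1) \<partial>M) \<longlonglongrightarrow> (\<integral>\<omega>. w * A \<omega> \<partial>M)"
      by (rule integral_dominated_convergence[OF _ _ G1]) (use lz dz in auto)
    then show "(\<lambda>n. sqrt (real n) * (integral\<^sup>L M (z n) - 1)) \<longlonglongrightarrow> w * integral\<^sup>L M A"
      by (simp add: int prob_space)
  qed
  note mx = means[OF _ bx lx dx] and my = means[OF _ bby ly dy]
  define ex where "ex n = integral\<^sup>L M (x n)" for n
  define ey where "ey n = integral\<^sup>L M (y n)" for n
  have epos: "0 < ex n" "0 < ey n" for n
    using mx(2)[of n] my(2)[of n] by (auto simp: ex_def ey_def)
  define D where "D n = (\<integral>\<omega>. (sqrt (x n \<omega>) - sqrt (y n \<omega>))\<^sup>2 \<partial>M)" for n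
  have all: "AE \<omega> in M. \<forall>n. 1 / 2 \<le> x n \<omega> \<and> 1 / 2 \<le> y n \<omega>"
    unfolding AE_all_countable
  proof
    fix n show "AE \<omega> in M. 1 / 2 \<le> x n \<omega> \<and> 1 / 2 \<le> y n \<omega>"
      using bx[of n] bby[of n] by eventually_elim auto
  qed
  have "(\<lambda>n. \<integral>\<omega>. real n * (sqrt (x n \<omega>) - sqrt (y n \<omega>))\<^sup>2 \<partial>M)
       \<longlonglongrightarrow> (\<integral>\<omega>. (s * A \<omega> - t * A \<omega>)\<^sup>2 / 4 \<partial>M)"
  proof (rule integral_dominated_convergence[where w = "\<lambda>\<omega>. 4 * (G \<omega>)\<^sup>2"])
    show "AE \<omega> in M. (\<lambda>n. real n * (sqrt (x n \<omega>) - sqrt (y n \<omega>))\<^sup>2) \<longlonglongrightarrow> (s * A \<omega> - t * A \<omega>)\<^sup>2 / 4"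
      using all lx ly
    proof eventually_elim
      case (elim \<omega>)
      have "0 < x n \<omega>" "0 < y n \<omega>" for n
        using elim(1)[rule_format, of n] by auto
      with elim show ?case by (intro tendsto_scaled_sqrt_diff)
    qed
    show "AE \<omega> in M. norm (real n * (sqrt (x n \<omega>) - sqrt (y n \<omega>))\<^sup>2) \<le> 4 * (G \<omega>)\<^sup>2" for n
      using all dx[of n] dy[of n]
    proof eventually_elim
      case (elim \<omega>)
      then show ?case
        using scaled_sqrt_diff_le[of "x n \<omega>" "y n \<omega>" "sqrt (real n)" "G \<omega>"]
        by (auto simp: power_mult_distrib)
    qed
  qed (use G2 in auto)
  also have "(\<integral>\<omega>. (s * A \<omega> - t * A \<omega>)\<^sup>2 / 4 \<partial>M) = (s - t)\<^sup>2 / 4 * (\<integral>\<omega>. (A \<omega>)\<^sup>2 \<partial>M)"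
    unfolding left_diff_distrib[symmetric] power_mult_distrib by simp
  finally have limD: "(\<lambda>n. real n * D n) \<longlonglongrightarrow> (s - t)\<^sup>2 / 4 * (\<integral>\<omega>. (A \<omega>)\<^sup>2 \<partial>M)"
    by (simp add: D_def)
  have limE: "(\<lambda>n. real n * (sqrt (ex n) - sqrt (ey n))\<^sup>2) \<longlonglongrightarrow> (s * integral\<^sup>L M A - t * integral\<^sup>L M A)\<^sup>2 / 4"
    using mx(3) my(3) epos by (intro tendsto_scaled_sqrt_diff) (auto simp: ex_def ey_def)
  have lim: "(\<lambda>n. (real n * D n - real n * (sqrt (ex n) - sqrt (ey n))\<^sup>2) / (2 * (sqrt (ex n) * sqrt (ey n))))
      \<longlonglongrightarrow> ((s - t)\<^sup>2 / 4 * (\<integral>\<omega>. (A \<omega>)\<^sup>2 \<partial>M) - (s * integral\<^sup>L M A - t * integral\<^sup>L M A)\<^sup>2 / 4) / (2 * (sqrt 1 * sqrt 1))"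
    using mx(3) my(3)
    by (intro tendsto_intros limD limE tendsto_of_scaled) (auto simp: ex_def[symmetric] ey_def[symmetric])
  have eq: "(real n * D n - real n * (sqrt (ex n) - sqrt (ey n))\<^sup>2) / (2 * (sqrt (ex n) * sqrt (ey n)))
     = real n * (1 - (\<integral>\<omega>. sqrt (x n \<omega> / integral\<^sup>L M (x n)) * sqrt (y n \<omega> / integral\<^sup>L M (y n)) \<partial>M))" for n
  proof -
    define B where "B = (\<integral>\<omega>. sqrt (x n \<omega>) * sqrt (y n \<omega>) \<partial>M)"
    have "integrable M (\<lambda>\<omega>. sqrt (x n \<omega>) * sqrt (y n \<omega>))"
    proof (rule integrable_const_bound)
      show "AE \<omega> in M. norm (sqrt (x n \<omega>) * sqrt (y n \<omega>)) \<le> 3 / 2"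
        using bx[of n] bby[of n]
      proof eventually_elim
        case (elim \<omega>)
        then show ?case using arith_geo_mean_sqrt[of "x n \<omega>" "y n \<omega>"] by (simp add: real_sqrt_mult)
      qed
    qed simp
    then have "(\<integral>\<omega>. x n \<omega> + y n \<omega> - 2 * (sqrt (x n \<omega>) * sqrt (y n \<omega>)) \<partial>M) = ex n + ey n - 2 * B"
      using mx(1)[of n] my(1)[of n] by (simp add: ex_def ey_def B_def)
    moreover have "D n = (\<integral>\<omega>. x n \<omega> + y n \<omega> - 2 * (sqrt (x n \<omega>) * sqrt (y n \<omega>)) \<partial>M)"
      unfolding D_def 
    proof (rule integral_cong_AE)
      show "AE \<omega> in M. (sqrt (x n \<omega>) - sqrt (y n \<omega>))\<^sup>2 = x n \<omega> + y n \<omega> - 2 * (sqrt (x n \<omega>) * sqrt (y n \<omega>))"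
        using all
      proof eventually_elim
        case (elim \<omega>)
        have "0 \<le> x n \<omega>" "0 \<le> y n \<omega>" using elim[rule_format, of n] by auto
        then show ?case by (simp add: power2_diff)
      qed
    qed simp_all
    ultimately have DB: "D n = ex n + ey n - 2 * B" by simp
    have q: "(\<integral>\<omega>. sqrt (x n \<omega> / integral\<^sup>L M (x n)) * sqrt (y n \<omega> / integral\<^sup>L M (y n)) \<partial>M)
       = B / (sqrt (ex n) * sqrt (ey n))"
      unfolding ex_def[symmetric] ey_def[symmetric] B_def real_sqrt_divide times_divide_times_eq by simp
    have p: "sqrt (ex n) * sqrt (ey n) > 0" using epos[of n] by simp
    have sd: "(sqrt (ex n) - sqrt (ey n))\<^sup>2 = ex n + ey n - 2 * (sqrt (ex n) * sqrt (ey n))"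
      using epos[of n] by (simp add: power2_diff)
    have "real n * D n - real n * (sqrt (ex n) - sqrt (ey n))\<^sup>2 = 2 * real n * (sqrt (ex n) * sqrt (ey n) - B)"
      unfolding DB sd by (simp add: algebra_simps)
    moreover have "2 * r * (w - b) / (2 * w) = r * (1 - b / w)" if "w > 0" for r w b :: real
      using that by (simp add: field_simps)
    ultimately show ?thesis unfolding q using p by presburger
  qed
  have "(s * m - t * m)\<^sup>2 = (s - t)\<^sup>2 * m\<^sup>2" for m :: real
    unfolding left_diff_distrib[symmetric] power_mult_distrib ..
  then have val: "((s - t)\<^sup>2 / 4 * X - (s * m - t * m)\<^sup>2 / 4) / (2 * (sqrt 1 * sqrt 1)) = (s - t)\<^sup>2 * (X - m\<^sup>2) / 8" for X m :: real
    by (simp add: right_diff_distrib diff_divide_distrib)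
  show ?thesis using lim unfolding eq val .
qed

section \<open>Square roots of densities and their products\<close>

text \<open>
  Square roots of densities are used instead of densities because the affinity of two measures is
  the inner product of their roots, and roots of product measures are products of roots.
\<close>

definition sqrt_density :: "'a measure \<Rightarrow> 'a measure \<Rightarrow> ('a \<Rightarrow> real) \<Rightarrow> bool" where
  "sqrt_density M P q \<longleftrightarrow> prob_space M \<and> prob_space P \<and> q \<in> borel_measurable M \<and>
     (\<forall>x\<in>space M. 0 \<le> q x) \<and> P = density M (\<lambda>x. ennreal ((q x)\<^sup>2))"

lemma sqrt_density_integrable:
  assumes "sqrt_density M P q"
  shows "integrable M (\<lambda>x. (q x)\<^sup>2)" "(\<integral>x. (q x)\<^sup>2 \<partial>M) = 1"
proof -
  have [measurable]: "q \<in> borel_measurable M" and P: "P = density M (\<lambda>x. ennreal ((q x)\<^sup>2))"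
    and "prob_space P" using assms by (auto simp: sqrt_density_def)
  have "emeasure P (space P) = 1" by (rule prob_space.emeasure_space_1) fact
  then have 1: "(\<integral>\<^sup>+x. ennreal ((q x)\<^sup>2) \<partial>M) = ennreal 1"
    unfolding P by (subst (asm) emeasure_density) (auto cong: nn_integral_cong)
  show "integrable M (\<lambda>x. (q x)\<^sup>2)" "(\<integral>x. (q x)\<^sup>2 \<partial>M) = 1"
    using nn_integral_eq_integrable[of "\<lambda>x. (q x)\<^sup>2" M 1] 1 by auto
qed

lemma PiM_density:
  fixes M :: "'i \<Rightarrow> 'a measure"
  assumes I: "finite I" and M: "\<And>i. i \<in> I \<Longrightarrow> sigma_finite_measure (M i)"
    and N: "\<And>i. i \<in> I \<Longrightarrow> sigma_finite_measure (density (M i) (\<phi> i))"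
    and \<phi>: "\<And>i. i \<in> I \<Longrightarrow> \<phi> i \<in> borel_measurable (M i)"
  shows "PiM I (\<lambda>i. density (M i) (\<phi> i)) = density (PiM I M) (\<lambda>x. \<Prod>i\<in>I. \<phi> i (x i))"
proof -
  (* the locale of product measures asks for sigma-finite factors at every index, so the indices
     outside I receive a one-point measure *)
  define M' where "M' i = (if i \<in> I then M i else count_space {undefined})" for i
  define N' where "N' i = (if i \<in> I then density (M i) (\<phi> i) else count_space {undefined})" for i
  have triv: "sigma_finite_measure (count_space {undefined :: 'a})"
    by (rule sigma_finite_measure_count_space_finite) simp
  interpret M': product_sigma_finite M' using M triv by (auto simp: product_sigma_finite_def M'_def)
  interpret N': product_sigma_finite N' using N triv by (auto simp: product_sigma_finite_def N'_def)
  have \<phi>'[measurable]: "i \<in> I \<Longrightarrow> \<phi> i \<in> borel_measurable (M' i)" for i using \<phi> by (simp add: M'_def)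
  have prod_meas: "(\<lambda>x. \<Prod>i\<in>I. g i (x i)) \<in> borel_measurable (PiM I M')"
    if "\<And>i. i \<in> I \<Longrightarrow> g i \<in> borel_measurable (M' i)" for g :: "'i \<Rightarrow> 'a \<Rightarrow> ennreal"
    by (intro borel_measurable_prod_ennreal measurable_compose[OF measurable_component_singleton] that)
  have "density (PiM I M') (\<lambda>x. \<Prod>i\<in>I. \<phi> i (x i)) = PiM I N'"
  proof (rule N'.PiM_eqI[OF I])
    show "sets (density (PiM I M') (\<lambda>x. \<Prod>i\<in>I. \<phi> i (x i))) = sets (PiM I N')"
      by (simp, intro sets_PiM_cong) (auto simp: M'_def N'_def)
    fix A assume "\<And>i. i \<in> I \<Longrightarrow> A i \<in> sets (N' i)"
    then have A: "\<And>i. i \<in> I \<Longrightarrow> A i \<in> sets (M' i)" by (auto simp: N'_def M'_def)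
    have "emeasure (density (PiM I M') (\<lambda>x. \<Prod>i\<in>I. \<phi> i (x i))) (Pi\<^sub>E I A)
        = (\<integral>\<^sup>+x. (\<Prod>i\<in>I. \<phi> i (x i)) * indicator (Pi\<^sub>E I A) x \<partial>PiM I M')"
      using A I by (intro emeasure_density prod_meas sets_PiM_I_finite) auto
    also have "\<dots> = (\<integral>\<^sup>+x. (\<Prod>i\<in>I. \<phi> i (x i) * indicator (A i) (x i)) \<partial>PiM I M')"
    proof (rule nn_integral_cong)
      fix x assume "x \<in> space (PiM I M')"
      then have "x \<in> extensional I" by (simp add: space_PiM PiE_def)
      then have "indicator (Pi\<^sub>E I A) x = (\<Prod>i\<in>I. indicator (A i) (x i) :: ennreal)"
      proof (cases "x \<in> Pi\<^sub>E I A")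
        case False
        then obtain i where "i \<in> I" "x i \<notin> A i" using \<open>x \<in> extensional I\<close> by (auto simp: PiE_iff)
        then have "(\<Prod>i\<in>I. indicator (A i) (x i) :: ennreal) = 0"
          using I by (intro prod_zero bexI[of _ i]) auto
        with False show ?thesis by simp
      qed (auto simp: PiE_iff)
      then show "(\<Prod>i\<in>I. \<phi> i (x i)) * indicator (Pi\<^sub>E I A) x = (\<Prod>i\<in>I. \<phi> i (x i) * indicator (A i) (x i))"
        by (simp add: prod.distrib)
    qed
    also have "\<dots> = (\<Prod>i\<in>I. \<integral>\<^sup>+x. \<phi> i x * indicator (A i) x \<partial>M' i)"
      using A by (intro M'.product_nn_integral_prod[OF I]) auto
    also have "\<dots> = (\<Prod>i\<in>I. emeasure (N' i) (A i))"
      using A by (intro prod.cong refl) (auto simp: N'_def M'_def emeasure_density \<phi>)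
    finally show "emeasure (density (PiM I M') (\<lambda>x. \<Prod>i\<in>I. \<phi> i (x i))) (Pi\<^sub>E I A) = (\<Prod>i\<in>I. emeasure (N' i) (A i))" .
  qed
  moreover have "PiM I M' = PiM I M" "PiM I N' = PiM I (\<lambda>i. density (M i) (\<phi> i))"
    by (intro PiM_cong; simp add: M'_def N'_def)+
  ultimately show ?thesis by simp
qed

lemma sqrt_density_PiM:
  fixes M :: "'i \<Rightarrow> 'a measure"
  assumes I: "finite I" and r: "\<And>i. i \<in> I \<Longrightarrow> sqrt_density (M i) (P i) (q i)"
  shows "sqrt_density (PiM I M) (PiM I P) (\<lambda>x. \<Prod>i\<in>I. q i (x i))"
proof -
  have ps: "i \<in> I \<Longrightarrow> prob_space (M i)" "i \<in> I \<Longrightarrow> prob_space (P i)"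
    and [measurable]: "i \<in> I \<Longrightarrow> q i \<in> borel_measurable (M i)"
    and P: "i \<in> I \<Longrightarrow> P i = density (M i) (\<lambda>x. ennreal ((q i x)\<^sup>2))"
    and nn: "i \<in> I \<Longrightarrow> x \<in> space (M i) \<Longrightarrow> 0 \<le> q i x" for i x
    using r[of i] by (auto simp: sqrt_density_def)
  have sf: "prob_space N \<Longrightarrow> sigma_finite_measure N" for N :: "'a measure"
    by (simp add: finite_measure_def prob_space_def)
  have "PiM I P = PiM I (\<lambda>i. density (M i) (\<lambda>x. ennreal ((q i x)\<^sup>2)))"
    by (intro PiM_cong refl P)
  also have "\<dots> = density (PiM I M) (\<lambda>x. \<Prod>i\<in>I. ennreal ((q i (x i))\<^sup>2))"
  proof (rule PiM_density[OF I])
    fix i assume i: "i \<in> I"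
    show "sigma_finite_measure (M i)" "sigma_finite_measure (density (M i) (\<lambda>x. ennreal ((q i x)\<^sup>2)))"
      using sf[OF ps(1)[OF i]] sf[OF ps(2)[OF i]] P[OF i] by simp_all
    show "(\<lambda>x. ennreal ((q i x)\<^sup>2)) \<in> borel_measurable (M i)" using i by simp
  qed
  also have "(\<lambda>x. \<Prod>i\<in>I. ennreal ((q i (x i))\<^sup>2)) = (\<lambda>x. ennreal ((\<Prod>i\<in>I. q i (x i))\<^sup>2))"
    by (simp add: prod_ennreal prod_power_distrib)
  finally show ?thesis
    unfolding sqrt_density_def
  proof (intro conjI ballI)
    show "prob_space (PiM I M)" "prob_space (PiM I P)" by (intro prob_space_PiM ps; assumption)+
    show "(\<lambda>x. \<Prod>i\<in>I. q i (x i)) \<in> borel_measurable (PiM I M)"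
      by (intro borel_measurable_prod measurable_compose[OF measurable_component_singleton]) simp_all
    show "0 \<le> (\<Prod>i\<in>I. q i (x i))" if "x \<in> space (PiM I M)" for x
      using that by (intro prod_nonneg nn) (auto simp: space_PiM PiE_iff)
  qed
qed

lemma affinity_PiM:
  fixes M :: "'i \<Rightarrow> 'a measure"
  assumes I: "finite I" and q: "\<And>i. i \<in> I \<Longrightarrow> sqrt_density (M i) (P i) (q i)"
    and q': "\<And>i. i \<in> I \<Longrightarrow> sqrt_density (M i) (P' i) (q' i)"
  shows "(\<integral>x. (\<Prod>i\<in>I. q i (x i)) * (\<Prod>i\<in>I. q' i (x i)) \<partial>PiM I M) = (\<Prod>i\<in>I. \<integral>x. q i x * q' i x \<partial>M i)"
proof -
  define M' where "M' i = (if i \<in> I then M i else count_space {undefined})" for i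
  have triv: "sigma_finite_measure (count_space {undefined :: 'a})"
    by (rule sigma_finite_measure_count_space_finite) simp
  have "i \<in> I \<Longrightarrow> sigma_finite_measure (M i)" for i
    using q[of i] by (simp add: sqrt_density_def finite_measure_def prob_space_def)
  then interpret M': product_sigma_finite M' using triv by (auto simp: product_sigma_finite_def M'_def)
  have "PiM I M = PiM I M'" by (intro PiM_cong) (auto simp: M'_def)
  then have "(\<integral>x. (\<Prod>i\<in>I. q i (x i)) * (\<Prod>i\<in>I. q' i (x i)) \<partial>PiM I M) = (\<integral>x. (\<Prod>i\<in>I. q i (x i) * q' i (x i)) \<partial>PiM I M')"
    by (simp add: prod.distrib)
  also have "\<dots> = (\<Prod>i\<in>I. \<integral>x. q i x * q' i x \<partial>M' i)"
  proof (rule M'.product_integral_prod[OF I])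
    fix i assume i: "i \<in> I"
    show "integrable (M' i) (\<lambda>x. q i x * q' i x)"
      using q[OF i] q'[OF i] i sqrt_density_integrable(1)[OF q[OF i]] sqrt_density_integrable(1)[OF q'[OF i]]
      by (auto simp: M'_def sqrt_density_def intro!: integrable_mult_of_squares)
  qed
  finally show ?thesis by (simp add: M'_def)
qed

lemma sqrt_density_pair:
  assumes "sqrt_density M P q" "sqrt_density N R p"
  shows "sqrt_density (M \<Otimes>\<^sub>M N) (P \<Otimes>\<^sub>M R) (\<lambda>(x, y). q x * p y)"
proof -
  have sf: "prob_space L \<Longrightarrow> sigma_finite_measure L" for L :: "'b measure"
    by (simp add: finite_measure_def prob_space_def)
  have ps: "prob_space M" "prob_space N" "prob_space P" "prob_space R"
    and [measurable]: "q \<in> borel_measurable M" "p \<in> borel_measurable N"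
    and D: "P = density M (\<lambda>x. ennreal ((q x)\<^sup>2))" "R = density N (\<lambda>x. ennreal ((p x)\<^sup>2))"
    using assms by (auto simp: sqrt_density_def)
  have "P \<Otimes>\<^sub>M R = density (M \<Otimes>\<^sub>M N) (\<lambda>(x, y). ennreal ((q x)\<^sup>2) * ennreal ((p y)\<^sup>2))"
    unfolding D
    using sf[OF ps(2)] sf[OF ps(4)] by (intro pair_measure_density) (simp_all add: D(2))
  also have "(\<lambda>(x, y). ennreal ((q x)\<^sup>2) * ennreal ((p y)\<^sup>2)) = (\<lambda>z. ennreal ((case z of (x, y) \<Rightarrow> q x * p y)\<^sup>2))"
    by (auto simp: ennreal_mult power_mult_distrib split: prod.splits)
  finally have "P \<Otimes>\<^sub>M R = density (M \<Otimes>\<^sub>M N) (\<lambda>z. ennreal ((case z of (x, y) \<Rightarrow> q x * p y)\<^sup>2))" .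
  moreover have "prob_space (M \<Otimes>\<^sub>M N)" "prob_space (P \<Otimes>\<^sub>M R)" using ps by (auto intro: prob_space_pair)
  ultimately show ?thesis
    using assms unfolding sqrt_density_def by (auto simp: space_pair_measure)
qed

lemma affinity_pair:
  assumes "sqrt_density M P q" "sqrt_density N R p" "sqrt_density M P' q'" "sqrt_density N R' p'"
  shows "(\<integral>z. (case z of (x, y) \<Rightarrow> q x * p y) * (case z of (x, y) \<Rightarrow> q' x * p' y) \<partial>(M \<Otimes>\<^sub>M N))
     = (\<integral>x. q x * q' x \<partial>M) * (\<integral>y. p y * p' y \<partial>N)"
proof -
  interpret M: prob_space M using assms by (simp add: sqrt_density_def)
  interpret N: prob_space N using assms by (simp add: sqrt_density_def)
  interpret pair_sigma_finite M N ..
  have [measurable]: "q \<in> borel_measurable M" "p \<in> borel_measurable N" "q' \<in> borel_measurable M" "p' \<in> borel_measurable N"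
    using assms by (auto simp: sqrt_density_def)
  have "integrable (M \<Otimes>\<^sub>M N) (\<lambda>z. (case z of (x, y) \<Rightarrow> q x * p y) * (case z of (x, y) \<Rightarrow> q' x * p' y))"
    using sqrt_density_integrable(1)[OF sqrt_density_pair[OF assms(1,2)]]
      sqrt_density_integrable(1)[OF sqrt_density_pair[OF assms(3,4)]]
    by (intro integrable_mult_of_squares) simp_all
  then have "(\<integral>z. (case z of (x, y) \<Rightarrow> q x * p y) * (case z of (x, y) \<Rightarrow> q' x * p' y) \<partial>(M \<Otimes>\<^sub>M N))
      = (\<integral>x. (\<integral>y. (q x * q' x) * (p y * p' y) \<partial>N) \<partial>M)"
    by (subst integral_fst'[symmetric]) (simp_all add: mult.assoc mult.left_commute)
  then show ?thesis by simp
qed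

section \<open>Marginal densities\<close>

(* keeps the simplifier from rewriting the full coordinate set {1..d} into {Suc 0..d} *)
declare One_nat_def [simp del]

text \<open>
  The weighted mean of \<open>(\<bar>a\<bar> - c)\<^sup>2\<close> is nonnegative, where \<open>c\<close> is the weighted mean of \<open>\<bar>a\<bar>\<close>.
\<close>

lemma weighted_Jensen:
  fixes a g :: "'a \<Rightarrow> real"
  assumes [measurable]: "a \<in> borel_measurable M"
    and g: "integrable M g" "\<And>x. x \<in> space M \<Longrightarrow> 0 \<le> g x" and a2: "integrable M (\<lambda>x. (a x)\<^sup>2 * g x)"
    and m: "0 < integral\<^sup>L M g"
  shows "integrable M (\<lambda>x. \<bar>a x\<bar> * g x)"
    "(\<integral>x. \<bar>a x\<bar> * g x \<partial>M) / integral\<^sup>L M g \<le> sqrt ((\<integral>x. (a x)\<^sup>2 * g x \<partial>M) / integral\<^sup>L M g)"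
proof -
  have [measurable]: "g \<in> borel_measurable M" using g by simp
  show int: "integrable M (\<lambda>x. \<bar>a x\<bar> * g x)"
  proof (rule Bochner_Integration.integrable_bound[OF Bochner_Integration.integrable_add[OF g(1) a2]])
    have "\<bar>b\<bar> \<le> 1 + b\<^sup>2" for b :: real
      using sum_squares_bound[of 1 "\<bar>b\<bar>"] by simp
    then have "\<bar>b\<bar> * c \<le> c + b\<^sup>2 * c" if "0 \<le> c" for b c :: real
      using mult_right_mono[OF _ that] by (metis distrib_right mult_1)
    then show "AE x in M. norm (\<bar>a x\<bar> * g x) \<le> norm (g x + (a x)\<^sup>2 * g x)"
      using g by (intro AE_I2) (simp add: abs_mult)
  qed simp
  define c where "c = (\<integral>x. \<bar>a x\<bar> * g x \<partial>M) / integral\<^sup>L M g"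
  have "0 \<le> (\<integral>x. (\<bar>a x\<bar> - c)\<^sup>2 * g x \<partial>M)"
    using g by (intro integral_nonneg_AE AE_I2) simp
  also have "(\<lambda>x. (\<bar>a x\<bar> - c)\<^sup>2 * g x) = (\<lambda>x. (a x)\<^sup>2 * g x - 2 * c * (\<bar>a x\<bar> * g x) + c\<^sup>2 * g x)"
    by (auto simp: power2_eq_square algebra_simps)
  also have "(\<integral>x. \<dots> x \<partial>M) = (\<integral>x. (a x)\<^sup>2 * g x \<partial>M) - 2 * c * (\<integral>x. \<bar>a x\<bar> * g x \<partial>M) + c\<^sup>2 * integral\<^sup>L M g"
    using int a2 g by simp
  also have "(\<integral>x. \<bar>a x\<bar> * g x \<partial>M) = c * integral\<^sup>L M g"
    using m by (simp add: c_def)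
  finally have "c\<^sup>2 * integral\<^sup>L M g \<le> (\<integral>x. (a x)\<^sup>2 * g x \<partial>M)"
    by (simp add: power2_eq_square algebra_simps)
  then have "c\<^sup>2 \<le> (\<integral>x. (a x)\<^sup>2 * g x \<partial>M) / integral\<^sup>L M g"
    using m by (simp add: pos_le_divide_eq)
  then show "c \<le> sqrt ((\<integral>x. (a x)\<^sup>2 * g x \<partial>M) / integral\<^sup>L M g)"
    by (rule real_le_rsqrt)
qed

text \<open>
  Taking for \<open>g\<close> the section of \<open>f\<close> at a fixed observed subvector, this differentiates the
  marginal density of the tilted law. The bound by the root of a second moment is a dominating
  function whose square is again integrable over the observed subvector.
\<close>

lemma weighted_mean_local_limit:
  fixes a g :: "'a \<Rightarrow> real" and t :: real
  assumes [measurable]: "a \<in> borel_measurable M"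
    and g: "integrable M g" "\<And>x. x \<in> space M \<Longrightarrow> 0 \<le> g x" and a2: "integrable M (\<lambda>x. (a x)\<^sup>2 * g x)"
    and m: "0 < integral\<^sup>L M g"
  defines "\<kappa> \<equiv> \<lambda>n. (\<integral>x. kfun (real n powr (- 1 / 2) * t * a x) * g x \<partial>M) / integral\<^sup>L M g"
  shows "(\<lambda>n. sqrt (real n) * (\<kappa> n - 1)) \<longlonglongrightarrow> t * ((\<integral>x. a x * g x \<partial>M) / integral\<^sup>L M g)"
    "\<bar>sqrt (real n) * (\<kappa> n - 1)\<bar> \<le> \<bar>t\<bar> * sqrt ((\<integral>x. (a x)\<^sup>2 * g x \<partial>M) / integral\<^sup>L M g)"
proof -
  have [measurable]: "g \<in> borel_measurable M" using g by simp
  note J = weighted_Jensen[OF assms(1) g a2 m]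
  define e where "e n x = sqrt (real n) * (kfun (real n powr (- 1 / 2) * t * a x) - 1) * g x" for n x
  have [measurable]: "e n \<in> borel_measurable M" for n unfolding e_def by measurable
  have e_le: "\<bar>e n x\<bar> \<le> \<bar>t\<bar> * (\<bar>a x\<bar> * g x)" if "x \<in> space M" for n x
  proof -
    have "\<bar>sqrt (real n) * (kfun (real n powr (- 1 / 2) * t * a x) - 1)\<bar> * g x \<le> \<bar>t * a x\<bar> * g x"
      using kfun_local_bound[of n "t * a x"] g(2)[OF that] by (intro mult_right_mono) (simp_all add: mult.assoc)
    then show ?thesis using g(2)[OF that] by (simp add: e_def abs_mult mult.assoc)
  qed
  have dom: "integrable M (\<lambda>x. \<bar>t\<bar> * (\<bar>a x\<bar> * g x))" using J(1) by simp
  have e_int: "integrable M (e n)" for n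
    by (rule Bochner_Integration.integrable_bound[OF dom]) (use e_le g in \<open>auto intro!: AE_I2 simp: abs_mult\<close>)
  have k_int: "integrable M (\<lambda>x. kfun (real n powr (- 1 / 2) * t * a x) * g x)" for n
  proof (rule Bochner_Integration.integrable_bound[of M "\<lambda>x. 3 / 2 * g x"])
    have "\<bar>kfun u * g x\<bar> \<le> \<bar>3 / 2 * g x\<bar>" for u x
      using kfun_bounds[of u] mult_right_mono[of "kfun u" "3 / 2" "\<bar>g x\<bar>"] by (simp add: abs_mult)
    then show "AE x in M. norm (kfun (real n powr (- 1 / 2) * t * a x) * g x) \<le> norm (3 / 2 * g x)" by auto
  qed (use g in simp_all)
  have \<kappa>: "sqrt (real n) * (\<kappa> n - 1) = integral\<^sup>L M (e n) / integral\<^sup>L M g" for n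
  proof -
    have "integral\<^sup>L M (e n) = sqrt (real n) * ((\<integral>x. kfun (real n powr (- 1 / 2) * t * a x) * g x \<partial>M) - integral\<^sup>L M g)"
      using k_int[of n] g(1) unfolding e_def by (simp add: left_diff_distrib mult.assoc)
    then show ?thesis using m by (simp add: \<kappa>_def field_simps)
  qed
  have "(\<lambda>n. integral\<^sup>L M (e n)) \<longlonglongrightarrow> (\<integral>x. t * a x * g x \<partial>M)"
  proof (rule integral_dominated_convergence[OF _ _ dom])
    show "AE x in M. (\<lambda>n. e n x) \<longlonglongrightarrow> t * a x * g x"
    proof (rule AE_I2)
      show "(\<lambda>n. e n x) \<longlonglongrightarrow> t * a x * g x" for x
        using tendsto_mult[OF kfun_local_linearisation[of "t * a x"] tendsto_const[of "g x"]]
        unfolding e_def by (simp only: mult.assoc)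
    qed
  qed (use e_le in auto)
  then have "(\<lambda>n. integral\<^sup>L M (e n) / integral\<^sup>L M g) \<longlonglongrightarrow> (\<integral>x. t * a x * g x \<partial>M) / integral\<^sup>L M g"
    by (intro tendsto_divide tendsto_const) (use m in auto)
  then show "(\<lambda>n. sqrt (real n) * (\<kappa> n - 1)) \<longlonglongrightarrow> t * ((\<integral>x. a x * g x \<partial>M) / integral\<^sup>L M g)"
    unfolding \<kappa> by (simp add: mult.assoc)
  have "\<bar>integral\<^sup>L M (e n)\<bar> \<le> (\<integral>x. \<bar>e n x\<bar> \<partial>M)" by (rule integral_abs_bound)
  also have "\<dots> \<le> (\<integral>x. \<bar>t\<bar> * (\<bar>a x\<bar> * g x) \<partial>M)"
    by (rule integral_mono[OF _ dom e_le]) (use e_int in auto)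
  finally have "\<bar>sqrt (real n) * (\<kappa> n - 1)\<bar> \<le> \<bar>t\<bar> * ((\<integral>x. \<bar>a x\<bar> * g x \<partial>M) / integral\<^sup>L M g)"
    unfolding \<kappa> using m by (simp add: divide_right_mono)
  also have "\<dots> \<le> \<bar>t\<bar> * sqrt ((\<integral>x. (a x)\<^sup>2 * g x \<partial>M) / integral\<^sup>L M g)"
    by (rule mult_left_mono[OF J(2) abs_ge_zero])
  finally show "\<bar>sqrt (real n) * (\<kappa> n - 1)\<bar> \<le> \<bar>t\<bar> * sqrt ((\<integral>x. (a x)\<^sup>2 * g x \<partial>M) / integral\<^sup>L M g)" .
qed

text \<open>
  Fubini's theorem for the coordinates inside and outside \<open>S\<close>, phrased for marginal densities.
\<close>

locale coordinate_split =
  fixes d :: nat and S :: "nat set"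
  assumes S_sub: "S \<subseteq> {1..d}"
begin

abbreviation "J \<equiv> {1..d} - S"

sublocale product_sigma_finite "\<lambda>_::nat. lborel :: real measure"
  by (simp add: product_sigma_finite_def lborel.sigma_finite_measure_axioms)

lemma split_simps[simp]: "S \<inter> J = {}" "finite S" "S \<union> J = {1..d}" "S \<union> {1..d} = {1..d}"
  using S_sub by (auto intro: finite_subset)

sublocale S: sigma_finite_measure "Leb S" by (rule sigma_finite) simp
sublocale J: sigma_finite_measure "Leb J" by (rule sigma_finite) simp
sublocale SJ: pair_sigma_finite "Leb S" "Leb J" ..

lemma merge_measurable[measurable]: "merge S J \<in> measurable (Leb S \<Otimes>\<^sub>M Leb J) (Leb {1..d})"
  using measurable_merge[of S J "\<lambda>_. lborel"] by simp

lemma restrict_measurable[measurable]: "(\<lambda>x. restrict x S) \<in> measurable (Leb {1..d}) (Leb S)"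
  using S_sub by (rule measurable_restrict_subset)

lemma merge_in_space: "y \<in> space (Leb S) \<Longrightarrow> z \<in> space (Leb J) \<Longrightarrow> merge S J (y, z) \<in> space (Leb {1..d})"
  using measurable_space[OF merge_measurable, of "(y, z)"] by (simp add: space_pair_measure)

lemma restrict_eq: "y \<in> space (Leb S) \<Longrightarrow> restrict y S = y"
  by (auto simp: space_PiM PiE_def extensional_restrict)

lemma section_measurable:
  "F \<in> borel_measurable (Leb {1..d}) \<Longrightarrow> y \<in> space (Leb S) \<Longrightarrow> (\<lambda>z. F (merge S J (y, z))) \<in> borel_measurable (Leb J)"
  by (rule measurable_compose[OF measurable_Pair1' measurable_compose[OF merge_measurable]])

lemma split_integrable:
  fixes F :: "point \<Rightarrow> real"
  assumes "integrable (Leb {1..d}) F"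
  shows "integrable (Leb S \<Otimes>\<^sub>M Leb J) (\<lambda>z. F (merge S J z))"
    using assms integrable_distr[OF merge_measurable, of F] distr_merge[of S J] by simp

lemma marginal_measurable[measurable]:
  assumes [measurable]: "F \<in> borel_measurable (Leb {1..d})"
  shows "marginal d S F \<in> borel_measurable (Leb S)"
  unfolding marginal_def[abs_def] by measurable

lemma AE_section_integrable:
  fixes F :: "point \<Rightarrow> real"
  assumes "integrable (Leb {1..d}) F"
  shows "AE y in Leb S. integrable (Leb J) (\<lambda>z. F (merge S J (y, z)))"
  using SJ.AE_integrable_fst'[OF split_integrable[OF assms]] .

lemma marginal_integral:
  assumes "integrable (Leb {1..d}) F"
  shows "integrable (Leb S) (marginal d S F)" "integral\<^sup>L (Leb S) (marginal d S F) = integral\<^sup>L (Leb {1..d}) F"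
  using SJ.integrable_fst'[OF split_integrable[OF assms]] product_integral_fold[of S J F] assms
  by (simp_all add: marginal_def[abs_def])

lemma marginal_weight:
  assumes y: "y \<in> space (Leb S)"
  shows "marginal d S (\<lambda>x. b (restrict x S) * F x) y = b y * marginal d S F y"
  unfolding marginal_def using y by (simp add: restrict_eq)

lemma marginal_nonneg:
  assumes "\<And>x. x \<in> space (Leb {1..d}) \<Longrightarrow> 0 \<le> F x" and y: "y \<in> space (Leb S)"
  shows "0 \<le> marginal d S F y"
  unfolding marginal_def using assms merge_in_space by (intro integral_nonneg_AE AE_I2) auto

lemma integral_weight:
  assumes "integrable (Leb {1..d}) (\<lambda>x. b (restrict x S) * F x)"
  shows "integrable (Leb S) (\<lambda>y. b y * marginal d S F y)"
    "(\<integral>x. b (restrict x S) * F x \<partial>Leb {1..d}) = (\<integral>y. b y * marginal d S F y \<partial>Leb S)"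
  using marginal_integral[OF assms]
  by (simp_all add: marginal_weight cong: Bochner_Integration.integrable_cong Bochner_Integration.integral_cong)

lemma nn_integral_weight:
  assumes F: "integrable (Leb {1..d}) F" "\<And>x. x \<in> space (Leb {1..d}) \<Longrightarrow> 0 \<le> F x"
    and b[measurable]: "b \<in> borel_measurable (Leb S)" and "\<And>y. y \<in> space (Leb S) \<Longrightarrow> 0 \<le> b y"
  shows "(\<integral>\<^sup>+x. ennreal (b (restrict x S) * F x) \<partial>Leb {1..d}) = (\<integral>\<^sup>+y. ennreal (b y * marginal d S F y) \<partial>Leb S)"
proof -
  have [measurable]: "F \<in> borel_measurable (Leb {1..d})" using F by simp
  have "(\<integral>\<^sup>+x. ennreal (b (restrict x S) * F x) \<partial>Leb {1..d})
     = (\<integral>\<^sup>+x. ennreal (b (restrict x S) * F x) \<partial>Leb (S \<union> J))" by simp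
  also have "\<dots> = (\<integral>\<^sup>+y. (\<integral>\<^sup>+z. ennreal (b (restrict (merge S J (y, z)) S) * F (merge S J (y, z))) \<partial>Leb J) \<partial>Leb S)"
    by (rule product_nn_integral_fold) simp_all
  also have "\<dots> = (\<integral>\<^sup>+y. ennreal (b y * marginal d S F y) \<partial>Leb S)"
  proof (rule nn_integral_cong_AE)
    show "AE y in Leb S. (\<integral>\<^sup>+z. ennreal (b (restrict (merge S J (y, z)) S) * F (merge S J (y, z))) \<partial>Leb J)
        = ennreal (b y * marginal d S F y)"
      using AE_section_integrable[OF F(1)] AE_space
    proof eventually_elim
      case (elim y)
      have "(\<integral>\<^sup>+z. ennreal (b (restrict (merge S J (y, z)) S) * F (merge S J (y, z))) \<partial>Leb J)
         = (\<integral>\<^sup>+z. ennreal (b y) * ennreal (F (merge S J (y, z))) \<partial>Leb J)"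
        using elim assms by (intro nn_integral_cong) (simp add: restrict_eq ennreal_mult merge_in_space)
      also have "\<dots> = ennreal (b y) * (\<integral>\<^sup>+z. ennreal (F (merge S J (y, z))) \<partial>Leb J)"
        using elim by (intro nn_integral_cmult) (simp add: section_measurable)
      also have "(\<integral>\<^sup>+z. ennreal (F (merge S J (y, z))) \<partial>Leb J) = ennreal (marginal d S F y)"
        unfolding marginal_def using elim F(2) merge_in_space by (intro nn_integral_eq_integral) auto
      finally show ?case
        using elim assms by (simp add: ennreal_mult marginal_nonneg restrict_eq)
    qed
  qed
  finally show ?thesis .
qed

lemma integrable_weight_iff:
  assumes F: "integrable (Leb {1..d}) F" "\<And>x. x \<in> space (Leb {1..d}) \<Longrightarrow> 0 \<le> F x"
    and b[measurable]: "b \<in> borel_measurable (Leb S)"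
  shows "integrable (Leb {1..d}) (\<lambda>x. b (restrict x S) * F x) \<longleftrightarrow> integrable (Leb S) (\<lambda>y. b y * marginal d S F y)"
proof -
  have [measurable]: "F \<in> borel_measurable (Leb {1..d})" using F by simp
  have *: "(\<integral>\<^sup>+x. ennreal (\<bar>b (restrict x S)\<bar> * F x) \<partial>Leb {1..d}) = (\<integral>\<^sup>+y. ennreal (\<bar>b y\<bar> * marginal d S F y) \<partial>Leb S)"
    by (rule nn_integral_weight[OF F]) auto
  have "(\<integral>\<^sup>+x. ennreal (norm (b (restrict x S) * F x)) \<partial>Leb {1..d}) = (\<integral>\<^sup>+x. ennreal (\<bar>b (restrict x S)\<bar> * F x) \<partial>Leb {1..d})"
    using F by (intro nn_integral_cong) (simp add: abs_mult)
  moreover have "(\<integral>\<^sup>+y. ennreal (norm (b y * marginal d S F y)) \<partial>Leb S) = (\<integral>\<^sup>+y. ennreal (\<bar>b y\<bar> * marginal d S F y) \<partial>Leb S)"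
    using F by (intro nn_integral_cong) (simp add: abs_mult marginal_nonneg)
  ultimately show ?thesis unfolding integrable_iff_bounded using * by simp
qed

end

section \<open>The partially observed samples\<close>

lemma prob_densityD:
  assumes "prob_density d f"
  shows "f \<in> borel_measurable (Leb {1..d})" "\<And>x. x \<in> space (Leb {1..d}) \<Longrightarrow> 0 \<le> f x"
    "integrable (Leb {1..d}) f" "integral\<^sup>L (Leb {1..d}) f = 1"
proof -
  show "f \<in> borel_measurable (Leb {1..d})" and nn: "\<And>x. x \<in> space (Leb {1..d}) \<Longrightarrow> 0 \<le> f x"
    using assms by (auto simp: prob_density_def)
  then show "integrable (Leb {1..d}) f" "integral\<^sup>L (Leb {1..d}) f = 1"
    using assms nn_integral_eq_integrable[of f "Leb {1..d}" 1] by (auto simp: prob_density_def AE_I2)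
qed

lemma law_prob_space:
  assumes "prob_density d f"
  shows "prob_space (law d f)"
  using assms by (auto intro!: prob_spaceI simp: law_def prob_density_def emeasure_density cong: nn_integral_cong)

lemma sets_law[simp, measurable_cong]: "sets (law d f) = sets (Leb {1..d})"
  and space_law[simp]: "space (law d f) = space (Leb {1..d})"
  by (simp_all add: law_def)

lemma law_integral:
  assumes f: "prob_density d f" and [measurable]: "\<phi> \<in> borel_measurable (Leb {1..d})"
  shows "integrable (law d f) \<phi> \<longleftrightarrow> integrable (Leb {1..d}) (\<lambda>x. \<phi> x * f x)"
    "integral\<^sup>L (law d f) \<phi> = (\<integral>x. \<phi> x * f x \<partial>Leb {1..d})"
proof -
  note [measurable] = prob_densityD(1)[OF f]
  have "AE x in Leb {1..d}. 0 \<le> f x" using prob_densityD(2)[OF f] by auto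
  then show "integrable (law d f) \<phi> \<longleftrightarrow> integrable (Leb {1..d}) (\<lambda>x. \<phi> x * f x)"
    "integral\<^sup>L (law d f) \<phi> = (\<integral>x. \<phi> x * f x \<partial>Leb {1..d})"
    unfolding law_def by (simp_all add: integrable_real_density integral_real_density mult.commute)
qed

text \<open>
  One partially observed sample. Its law \<open>Q\<close> at the density \<open>f\<close> is the reference measure for the
  laws at the perturbed densities.
\<close>

locale biased_sample = coordinate_split +
  fixes f :: "point \<Rightarrow> real" and r :: "nat set \<Rightarrow> point \<Rightarrow> real"
  assumes f: "prob_density d f"
    and r_measurable[measurable]: "r S \<in> borel_measurable (Leb S)"
    and r_pos: "\<And>y. y \<in> space (Leb S) \<Longrightarrow> 0 < r S y"
    and r_integrable: "integrable (Leb S) (\<lambda>y. r S y * marginal d S f y)"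
begin

abbreviation "fS \<equiv> marginal d S f"
abbreviation "rbar \<equiv> normalised d r S f"
abbreviation "Q \<equiv> partial_law d r S f"

text \<open>
  A version of the conditional expectation of \<open>\<phi>(X)\<close> given \<open>X\<^sub>S = y\<close>. Being an explicit quotient
  of integrals, it admits pointwise limits for almost every \<open>y\<close>. Where \<open>f\<^sub>S\<close> vanishes its value is 0.
\<close>

definition cond :: "(point \<Rightarrow> real) \<Rightarrow> point \<Rightarrow> real" where
  "cond \<phi> y = marginal d S (\<lambda>x. \<phi> x * f x) y / fS y"

lemmas f_measurable[measurable] = prob_densityD(1)[OF f]
lemmas f_nonneg = prob_densityD(2)[OF f]
lemmas f_integrable = prob_densityD(3)[OF f]
lemmas f_integral = prob_densityD(4)[OF f]

lemma fS_nonneg: "y \<in> space (Leb S) \<Longrightarrow> 0 \<le> fS y"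
  using f_nonneg by (rule marginal_nonneg)

lemma fS_integral: "integrable (Leb S) fS" "integral\<^sup>L (Leb S) fS = 1"
  using marginal_integral[OF f_integrable] f_integral by auto

lemma r_mean_pos: "0 < (\<integral>y. r S y * fS y \<partial>Leb S)"
proof -
  have nn: "AE y in Leb S. 0 \<le> r S y * fS y"
    using r_pos fS_nonneg by (intro AE_I2) (simp add: less_imp_le)
  have "(\<integral>y. r S y * fS y \<partial>Leb S) \<noteq> 0"
  proof
    assume "(\<integral>y. r S y * fS y \<partial>Leb S) = 0"
    then have "AE y in Leb S. r S y * fS y = 0"
      using integral_nonneg_eq_0_iff_AE[OF r_integrable nn] by simp
    then have "AE y in Leb S. fS y = 0"
      using AE_space by eventually_elim (use r_pos in force)
    then have "integral\<^sup>L (Leb S) fS = 0" by (subst integral_cong_AE[where g = "\<lambda>_. 0"]) auto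
    then show False using fS_integral by simp
  qed
  then show ?thesis using integral_nonneg_AE[OF nn] by linarith
qed

lemma rbar_measurable[measurable]: "rbar \<in> borel_measurable (Leb S)"
  unfolding normalised_def[abs_def] by measurable

lemma rbar_pos: "y \<in> space (Leb S) \<Longrightarrow> 0 < rbar y"
  using r_pos r_mean_pos by (simp add: normalised_def)

lemma rbar_fS_integral: "integrable (Leb S) (\<lambda>y. rbar y * fS y)" "(\<integral>y. rbar y * fS y \<partial>Leb S) = 1"
  using r_integrable r_mean_pos by (simp_all add: normalised_def)

lemma rbar_fS_nonneg: "y \<in> space (Leb S) \<Longrightarrow> 0 \<le> rbar y * fS y"
  using rbar_pos fS_nonneg by (simp add: less_imp_le)

lemma sets_Q[simp, measurable_cong]: "sets Q = sets (Leb S)" and space_Q[simp]: "space Q = space (Leb S)"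
  by (simp_all add: partial_law_def)

lemma Q_prob_space: "prob_space Q"
proof
  have "emeasure Q (space Q) = (\<integral>\<^sup>+y. ennreal (rbar y * fS y) \<partial>Leb S)"
    unfolding partial_law_def by (simp add: emeasure_density cong: nn_integral_cong)
  also have "\<dots> = ennreal (\<integral>y. rbar y * fS y \<partial>Leb S)"
    using rbar_fS_integral(1) rbar_fS_nonneg by (intro nn_integral_eq_integral) auto
  finally show "emeasure Q (space Q) = 1" by (simp add: rbar_fS_integral)
qed

lemma Q_integral:
  assumes [measurable]: "\<phi> \<in> borel_measurable (Leb S)"
  shows "integrable Q \<phi> \<longleftrightarrow> integrable (Leb S) (\<lambda>y. rbar y * \<phi> y * fS y)"
    "integral\<^sup>L Q \<phi> = (\<integral>y. rbar y * \<phi> y * fS y \<partial>Leb S)"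
proof -
  have eq: "(\<lambda>y. rbar y * fS y * \<phi> y) = (\<lambda>y. rbar y * \<phi> y * fS y)" by (simp add: mult_ac)
  have "AE y in Leb S. 0 \<le> rbar y * fS y" using rbar_fS_nonneg by auto
  then show "integrable Q \<phi> \<longleftrightarrow> integrable (Leb S) (\<lambda>y. rbar y * \<phi> y * fS y)"
    "integral\<^sup>L Q \<phi> = (\<integral>y. rbar y * \<phi> y * fS y \<partial>Leb S)"
    unfolding partial_law_def eq[symmetric] by (simp_all add: integrable_real_density integral_real_density)
qed

lemma Q_integral_eq_law_integral:
  assumes [measurable]: "\<phi> \<in> borel_measurable (Leb S)"
  shows "integrable Q \<phi> \<longleftrightarrow> integrable (law d f) (\<lambda>x. rbar (restrict x S) * \<phi> (restrict x S))"
    "integral\<^sup>L Q \<phi> = integral\<^sup>L (law d f) (\<lambda>x. rbar (restrict x S) * \<phi> (restrict x S))"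
proof -
  show iff: "integrable Q \<phi> \<longleftrightarrow> integrable (law d f) (\<lambda>x. rbar (restrict x S) * \<phi> (restrict x S))"
    using integrable_weight_iff[OF f_integrable f_nonneg, of "\<lambda>y. rbar y * \<phi> y"]
    by (simp add: Q_integral law_integral[OF f])
  show "integral\<^sup>L Q \<phi> = integral\<^sup>L (law d f) (\<lambda>x. rbar (restrict x S) * \<phi> (restrict x S))"
  proof (cases "integrable Q \<phi>")
    case True
    then have "integrable (Leb {1..d}) (\<lambda>x. rbar (restrict x S) * \<phi> (restrict x S) * f x)"
      using iff by (simp add: law_integral[OF f])
    from integral_weight(2)[of "\<lambda>y. rbar y * \<phi> y" f, OF this] show ?thesis by (simp add: Q_integral law_integral[OF f])
  qed (use iff in \<open>simp add: not_integrable_integral_eq\<close>)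
qed

text \<open>
  The law \<open>Q\<close> charges only points at which the marginal density is positive.
\<close>

lemma AE_QI:
  assumes "AE y in Leb S. 0 < fS y \<longrightarrow> P y"
  shows "AE y in Q. P y"
proof -
  have "AE y in Leb S. 0 < ennreal (rbar y * fS y) \<longrightarrow> P y"
    using assms AE_space
  proof eventually_elim
    case (elim y)
    then show ?case using rbar_pos[of y] by (auto simp: ennreal_zero_less_mult_iff zero_less_mult_iff)
  qed
  then show ?thesis unfolding partial_law_def by (subst AE_density) auto
qed

lemma cond_measurable[measurable]:
  assumes [measurable]: "\<phi> \<in> borel_measurable (Leb {1..d})"
  shows "cond \<phi> \<in> borel_measurable (Leb S)"
  unfolding cond_def[abs_def] by measurable

text \<open>
  Where \<open>f\<^sub>S\<close> vanishes, \<open>f\<close> vanishes almost everywhere on the section, so both sides are 0.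
\<close>

lemma AE_cond_mult:
  assumes [measurable]: "\<phi> \<in> borel_measurable (Leb {1..d})"
  shows "AE y in Leb S. cond \<phi> y * fS y = marginal d S (\<lambda>x. \<phi> x * f x) y"
  using AE_section_integrable[OF f_integrable] AE_space
proof eventually_elim
  case (elim y)
  have "marginal d S (\<lambda>x. \<phi> x * f x) y = 0" if "fS y = 0"
  proof -
    have "AE z in Leb J. 0 \<le> f (merge S J (y, z))"
      using f_nonneg merge_in_space elim by auto
    then have "AE z in Leb J. f (merge S J (y, z)) = 0"
      using integral_nonneg_eq_0_iff_AE[OF elim(1)] that by (simp add: marginal_def)
    then have "AE z in Leb J. \<phi> (merge S J (y, z)) * f (merge S J (y, z)) = 0" by eventually_elim simp
    then show ?thesis unfolding marginal_def
      by (subst integral_cong_AE[where g = "\<lambda>_. 0"]) (use elim in \<open>auto intro!: section_measurable\<close>)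
  qed
  then show ?case by (auto simp: cond_def)
qed

lemma bounded_weight_integrable:
  assumes [measurable]: "\<phi> \<in> borel_measurable (Leb {1..d})" and "\<And>x. \<bar>\<phi> x\<bar> \<le> c"
  shows "integrable (Leb {1..d}) (\<lambda>x. \<phi> x * f x)"
proof (rule Bochner_Integration.integrable_bound)
  show "integrable (Leb {1..d}) (\<lambda>x. c * f x)" using f_integrable by simp
  have "\<bar>\<phi> x * f x\<bar> \<le> \<bar>c * f x\<bar>" for x
    using assms(2)[of x] by (simp add: abs_mult mult_right_mono)
  then show "AE x in Leb {1..d}. norm (\<phi> x * f x) \<le> norm (c * f x)" by auto
qed simp

lemma AE_cond_bounds:
  assumes [measurable]: "\<phi> \<in> borel_measurable (Leb {1..d})" and b: "\<And>x. l \<le> \<phi> x" "\<And>x. \<phi> x \<le> u"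
  shows "AE y in Leb S. 0 < fS y \<longrightarrow> l \<le> cond \<phi> y \<and> cond \<phi> y \<le> u"
proof -
  have "\<bar>\<phi> x\<bar> \<le> max \<bar>l\<bar> \<bar>u\<bar>" for x using b[of x] by linarith
  then have "integrable (Leb {1..d}) (\<lambda>x. \<phi> x * f x)" by (rule bounded_weight_integrable[rotated]) simp
  from AE_section_integrable[OF f_integrable] AE_section_integrable[OF this] AE_space
  show ?thesis
  proof eventually_elim
    case (elim y)
    have nn: "0 \<le> f (merge S J (y, z))" if "z \<in> space (Leb J)" for z
      using that elim f_nonneg merge_in_space by auto
    have "(\<integral>z. l * f (merge S J (y, z)) \<partial>Leb J) \<le> marginal d S (\<lambda>x. \<phi> x * f x) y"
      unfolding marginal_def using elim b nn by (intro integral_mono mult_right_mono) simp_all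
    moreover have "marginal d S (\<lambda>x. \<phi> x * f x) y \<le> (\<integral>z. u * f (merge S J (y, z)) \<partial>Leb J)"
      unfolding marginal_def using elim b nn by (intro integral_mono mult_right_mono) simp_all
    moreover have "(\<integral>z. f (merge S J (y, z)) \<partial>Leb J) = fS y" by (simp only: marginal_def)
    ultimately show ?case
      by (simp add: cond_def pos_le_divide_eq pos_divide_le_eq)
  qed
qed


text \<open>
  Holds at every \<open>y\<close> at which the sections of \<open>f\<close> and \<open>\<alpha>\<^sup>2 f\<close> are integrable: there the quotients
  \<open>cond\<close> are weighted means over the section.
\<close>

lemma AE_cond_local_limit:
  assumes \<alpha>: "\<alpha> \<in> L2 d f"
  shows "AE y in Leb S. 0 < fS y \<longrightarrow>
    (\<lambda>n. sqrt (real n) * (cond (\<lambda>x. kfun (real n powr (- 1 / 2) * t * \<alpha> x)) y - 1)) \<longlonglongrightarrow> t * cond \<alpha> y \<and>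
    (\<forall>n. \<bar>sqrt (real n) * (cond (\<lambda>x. kfun (real n powr (- 1 / 2) * t * \<alpha> x)) y - 1)\<bar>
       \<le> \<bar>t\<bar> * sqrt (cond (\<lambda>x. (\<alpha> x)\<^sup>2) y)) \<and>
    (cond \<alpha> y)\<^sup>2 \<le> cond (\<lambda>x. (\<alpha> x)\<^sup>2) y"
proof -
  have [measurable]: "\<alpha> \<in> borel_measurable (Leb {1..d})" and "integrable (Leb {1..d}) (\<lambda>x. (\<alpha> x)\<^sup>2 * f x)"
    using \<alpha> by (auto simp: L2_def)
  from AE_section_integrable[OF f_integrable] AE_section_integrable[OF this(2)] AE_space
  show ?thesis
  proof (eventually_elim, intro impI)
    fix y assume y: "integrable (Leb J) (\<lambda>z. f (merge S J (y, z)))"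
      "integrable (Leb J) (\<lambda>z. (\<alpha> (merge S J (y, z)))\<^sup>2 * f (merge S J (y, z)))" "y \<in> space (Leb S)"
      and pos: "0 < fS y"
    have mg: "0 < (\<integral>z. f (merge S J (y, z)) \<partial>Leb J)" using pos by (simp only: marginal_def)
    have am: "(\<lambda>z. \<alpha> (merge S J (y, z))) \<in> borel_measurable (Leb J)" using y by (simp add: section_measurable)
    have nn: "0 \<le> f (merge S J (y, z))" if "z \<in> space (Leb J)" for z
      using that y f_nonneg merge_in_space by auto
    note L = weighted_mean_local_limit[OF am y(1) nn y(2) mg]
    note W = weighted_Jensen[OF am y(1) nn y(2) mg]
    have 1: "(\<lambda>n. sqrt (real n) * (cond (\<lambda>x. kfun (real n powr (- 1 / 2) * t * \<alpha> x)) y - 1)) \<longlonglongrightarrow> t * cond \<alpha> y"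
      using L(1)[of t] unfolding cond_def marginal_def by simp
    have 2: "\<bar>sqrt (real n) * (cond (\<lambda>x. kfun (real n powr (- 1 / 2) * t * \<alpha> x)) y - 1)\<bar>
       \<le> \<bar>t\<bar> * sqrt (cond (\<lambda>x. (\<alpha> x)\<^sup>2) y)" for n
      using L(2)[of n t] unfolding cond_def marginal_def by simp
    have "\<bar>cond \<alpha> y\<bar> \<le> (\<integral>z. \<bar>\<alpha> (merge S J (y, z))\<bar> * f (merge S J (y, z)) \<partial>Leb J) / fS y"
    proof -
      have "\<bar>\<integral>z. \<alpha> (merge S J (y, z)) * f (merge S J (y, z)) \<partial>Leb J\<bar>
         \<le> (\<integral>z. \<bar>\<alpha> (merge S J (y, z)) * f (merge S J (y, z))\<bar> \<partial>Leb J)" by (rule integral_abs_bound)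
      also have "\<dots> = (\<integral>z. \<bar>\<alpha> (merge S J (y, z))\<bar> * f (merge S J (y, z)) \<partial>Leb J)"
        using nn by (intro Bochner_Integration.integral_cong) (simp_all add: abs_mult)
      finally show ?thesis using pos by (simp add: cond_def marginal_def[of d S "\<lambda>x. \<alpha> x * f x"] divide_right_mono)
    qed
    also have "\<dots> \<le> sqrt (cond (\<lambda>x. (\<alpha> x)\<^sup>2) y)"
      using W(2) unfolding cond_def marginal_def .
    finally have "(\<bar>cond \<alpha> y\<bar>)\<^sup>2 \<le> (sqrt (cond (\<lambda>x. (\<alpha> x)\<^sup>2) y))\<^sup>2" by (rule power_mono) simp
    moreover have "0 \<le> cond (\<lambda>x. (\<alpha> x)\<^sup>2) y"
      using y(3) f_nonneg fS_nonneg unfolding cond_def by (intro divide_nonneg_nonneg marginal_nonneg) auto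
    ultimately have 3: "(cond \<alpha> y)\<^sup>2 \<le> cond (\<lambda>x. (\<alpha> x)\<^sup>2) y" by simp
    from 1 2 3 show "(\<lambda>n. sqrt (real n) * (cond (\<lambda>x. kfun (real n powr (- 1 / 2) * t * \<alpha> x)) y - 1)) \<longlonglongrightarrow> t * cond \<alpha> y \<and>
    (\<forall>n. \<bar>sqrt (real n) * (cond (\<lambda>x. kfun (real n powr (- 1 / 2) * t * \<alpha> x)) y - 1)\<bar>
       \<le> \<bar>t\<bar> * sqrt (cond (\<lambda>x. (\<alpha> x)\<^sup>2) y)) \<and>
    (cond \<alpha> y)\<^sup>2 \<le> cond (\<lambda>x. (\<alpha> x)\<^sup>2) y" by blast
  qed
qed

lemma cond_integrable:
  assumes [measurable]: "\<phi> \<in> borel_measurable (Leb {1..d})" and "integrable (Leb {1..d}) (\<lambda>x. \<phi> x * f x)"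
  shows "integrable (Leb S) (\<lambda>y. cond \<phi> y * fS y)"
proof -
  have "AE y in Leb S. marginal d S (\<lambda>x. \<phi> x * f x) y = cond \<phi> y * fS y"
    using AE_cond_mult[OF assms(1)] by eventually_elim simp
  from integrable_cong_AE_imp[OF marginal_integral(1)[OF assms(2)] _ this] show ?thesis by simp
qed

lemma cond_square_integrable:
  assumes \<alpha>: "\<alpha> \<in> L2 d f"
  shows "integrable (Leb S) (\<lambda>y. (cond \<alpha> y)\<^sup>2 * fS y)"
proof -
  have [measurable]: "\<alpha> \<in> borel_measurable (Leb {1..d})" and i: "integrable (Leb {1..d}) (\<lambda>x. (\<alpha> x)\<^sup>2 * f x)"
    using \<alpha> by (auto simp: L2_def)
  have W: "integrable (Leb S) (\<lambda>y. cond (\<lambda>x. (\<alpha> x)\<^sup>2) y * fS y)" by (rule cond_integrable[OF _ i]) measurable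
  show ?thesis
  proof (rule Bochner_Integration.integrable_bound[OF W])
    show "AE y in Leb S. norm ((cond \<alpha> y)\<^sup>2 * fS y) \<le> norm (cond (\<lambda>x. (\<alpha> x)\<^sup>2) y * fS y)"
      using AE_cond_local_limit[OF \<alpha>, of 0] AE_space
    proof eventually_elim
      case (elim y)
      have "0 \<le> fS y" using elim by (intro fS_nonneg)
      with elim(1) show ?case by (cases "fS y = 0") (auto simp: abs_mult intro!: mult_right_mono)
    qed
  qed measurable
qed

text \<open>
  The tower property of conditional expectations.
\<close>

lemma law_cond_mult:
  assumes [measurable]: "\<alpha> \<in> borel_measurable (Leb {1..d})" "b \<in> borel_measurable (Leb S)"
    and int: "integrable (law d f) (\<lambda>x. b (restrict x S) * \<alpha> x)"
  shows "integrable (law d f) (\<lambda>x. b (restrict x S) * cond \<alpha> (restrict x S))"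
    "(\<integral>x. b (restrict x S) * cond \<alpha> (restrict x S) \<partial>law d f) = (\<integral>x. b (restrict x S) * \<alpha> x \<partial>law d f)"
proof -
  have i: "integrable (Leb {1..d}) (\<lambda>x. b (restrict x S) * (\<alpha> x * f x))"
    using int by (simp add: law_integral[OF f] mult.assoc)
  note w = integral_weight[of b "\<lambda>x. \<alpha> x * f x", OF i]
  have ae: "AE y in Leb S. b y * marginal d S (\<lambda>x. \<alpha> x * f x) y = b y * cond \<alpha> y * fS y"
    using AE_cond_mult[OF assms(1)] by eventually_elim simp
  have i2: "integrable (Leb S) (\<lambda>y. b y * cond \<alpha> y * fS y)"
    by (rule integrable_cong_AE_imp[OF w(1) _ ae]) measurable
  have i3: "integrable (Leb {1..d}) (\<lambda>x. b (restrict x S) * cond \<alpha> (restrict x S) * f x)"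
    using integrable_weight_iff[OF f_integrable f_nonneg, of "\<lambda>y. b y * cond \<alpha> y"] i2 by simp
  then show "integrable (law d f) (\<lambda>x. b (restrict x S) * cond \<alpha> (restrict x S))"
    by (simp add: law_integral[OF f])
  have "(\<integral>x. b (restrict x S) * cond \<alpha> (restrict x S) \<partial>law d f) = (\<integral>y. b y * cond \<alpha> y * fS y \<partial>Leb S)"
    using integral_weight(2)[of "\<lambda>y. b y * cond \<alpha> y" f, OF i3] by (simp add: law_integral[OF f])
  also have "\<dots> = (\<integral>y. b y * marginal d S (\<lambda>x. \<alpha> x * f x) y \<partial>Leb S)"
    by (rule integral_cong_AE) (use ae in \<open>auto intro!: borel_measurable_times marginal_measurable\<close>)
  also have "\<dots> = (\<integral>x. b (restrict x S) * \<alpha> x \<partial>law d f)"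
    unfolding w(2)[symmetric] by (simp add: law_integral[OF f] mult.assoc)
  finally show "(\<integral>x. b (restrict x S) * cond \<alpha> (restrict x S) \<partial>law d f) = (\<integral>x. b (restrict x S) * \<alpha> x \<partial>law d f)" .
qed

text \<open>
  The boundedness of the normalised weight lets integrability pass from \<open>f\<^sub>S\<close> to the density
  \<open>rbar f\<^sub>S\<close> of the sample.
\<close>

lemma Q_integrable_dominated:
  assumes bd: "AE y in density (Leb S) (\<lambda>y. ennreal (fS y)). rbar y \<le> C"
    and [measurable]: "g \<in> borel_measurable (Leb S)" and int: "integrable (Leb S) (\<lambda>y. g y * fS y)"
  shows "integrable Q g"
proof -
  have bd': "AE y in Leb S. 0 < fS y \<longrightarrow> rbar y \<le> C"
  proof -
    have "AE y in Leb S. 0 < ennreal (fS y) \<longrightarrow> rbar y \<le> C"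
      using bd by (simp add: AE_density)
    then show ?thesis by eventually_elim simp
  qed
  have "integrable (Leb S) (\<lambda>y. rbar y * g y * fS y)"
  proof (rule Bochner_Integration.integrable_bound[of "Leb S" "\<lambda>y. C * (g y * fS y)"])
    show "AE y in Leb S. norm (rbar y * g y * fS y) \<le> norm (C * (g y * fS y))"
      using bd' AE_space
    proof eventually_elim
      case (elim y)
      have "0 \<le> fS y" "0 < rbar y" using elim by (auto intro: fS_nonneg rbar_pos)
      with elim(1) show ?case
        by (cases "fS y = 0") (auto simp: abs_mult mult.assoc intro!: mult_right_mono)
    qed
  qed (use int in simp_all)
  then show ?thesis by (simp add: Q_integral)
qed

text \<open>
  The score of the sample is \<open>cond \<alpha>\<close>, the conditional mean of the score of a complete
  observation.
\<close>

lemma partial_affinity_limit: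
  assumes \<alpha>: "\<alpha> \<in> L2 d f" and bd: "AE y in density (Leb S) (\<lambda>y. ennreal (fS y)). rbar y \<le> C"
  defines "K \<equiv> \<lambda>n t. cond (\<lambda>x. kfun (real n powr (- 1 / 2) * t * \<alpha> x))"
  shows "(\<lambda>n. real n * (1 - (\<integral>y. sqrt (K n s y / integral\<^sup>L Q (K n s)) * sqrt (K n t y / integral\<^sup>L Q (K n t)) \<partial>Q)))
     \<longlonglongrightarrow> (s - t)\<^sup>2 * ((\<integral>y. (cond \<alpha> y)\<^sup>2 \<partial>Q) - (\<integral>y. cond \<alpha> y \<partial>Q)\<^sup>2) / 8"
proof (rule affinity_limit[where G = "\<lambda>y. max \<bar>s\<bar> \<bar>t\<bar> * sqrt (cond (\<lambda>x. (\<alpha> x)\<^sup>2) y)"])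
  have [measurable]: "\<alpha> \<in> borel_measurable (Leb {1..d})" and i: "integrable (Leb {1..d}) (\<lambda>x. (\<alpha> x)\<^sup>2 * f x)"
    using \<alpha> by (auto simp: L2_def)
  show "prob_space Q" by (rule Q_prob_space)
  show "K n s \<in> borel_measurable Q" "K n t \<in> borel_measurable Q" for n
    unfolding K_def by measurable
  show "cond \<alpha> \<in> borel_measurable Q" "(\<lambda>y. max \<bar>s\<bar> \<bar>t\<bar> * sqrt (cond (\<lambda>x. (\<alpha> x)\<^sup>2) y)) \<in> borel_measurable Q"
    by measurable
  have bds: "AE y in Q. 1 / 2 \<le> K n t y \<and> K n t y \<le> 3 / 2" for n t
    unfolding K_def by (intro AE_QI AE_cond_bounds kfun_bounds) measurable
  show "AE y in Q. 1 / 2 \<le> K n s y \<and> K n s y \<le> 3 / 2" "AE y in Q. 1 / 2 \<le> K n t y \<and> K n t y \<le> 3 / 2" for n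
    by (rule bds)+
  have lim: "AE y in Q. (\<lambda>n. sqrt (real n) * (K n t y - 1)) \<longlonglongrightarrow> t * cond \<alpha> y" for t
    unfolding K_def by (rule AE_QI) (use AE_cond_local_limit[OF \<alpha>, of t] in eventually_elim, simp)
  show "AE y in Q. (\<lambda>n. sqrt (real n) * (K n s y - 1)) \<longlonglongrightarrow> s * cond \<alpha> y"
    "AE y in Q. (\<lambda>n. sqrt (real n) * (K n t y - 1)) \<longlonglongrightarrow> t * cond \<alpha> y" by (rule lim)+
  have nonneg: "AE y in Q. 0 \<le> cond (\<lambda>x. (\<alpha> x)\<^sup>2) y"
    by (rule AE_QI) (use AE_cond_local_limit[OF \<alpha>, of 0] in eventually_elim, meson order_trans zero_le_power2)
  have dom: "AE y in Q. \<bar>sqrt (real n) * (K n u y - 1)\<bar> \<le> \<bar>u\<bar> * sqrt (cond (\<lambda>x. (\<alpha> x)\<^sup>2) y)" for n u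
    unfolding K_def by (rule AE_QI) (use AE_cond_local_limit[OF \<alpha>, of u] in eventually_elim, simp)
  have dom': "AE y in Q. \<bar>sqrt (real n) * (K n u y - 1)\<bar> \<le> max \<bar>s\<bar> \<bar>t\<bar> * sqrt (cond (\<lambda>x. (\<alpha> x)\<^sup>2) y)"
    if "\<bar>u\<bar> \<le> max \<bar>s\<bar> \<bar>t\<bar>" for n u
    using dom[of n u] nonneg
  proof eventually_elim
    case (elim y)
    have "\<bar>u\<bar> * sqrt (cond (\<lambda>x. (\<alpha> x)\<^sup>2) y) \<le> max \<bar>s\<bar> \<bar>t\<bar> * sqrt (cond (\<lambda>x. (\<alpha> x)\<^sup>2) y)"
      using that elim by (intro mult_right_mono) auto
    with elim show ?case by linarith
  qed
  show "AE y in Q. \<bar>sqrt (real n) * (K n s y - 1)\<bar> \<le> max \<bar>s\<bar> \<bar>t\<bar> * sqrt (cond (\<lambda>x. (\<alpha> x)\<^sup>2) y)"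
    "AE y in Q. \<bar>sqrt (real n) * (K n t y - 1)\<bar> \<le> max \<bar>s\<bar> \<bar>t\<bar> * sqrt (cond (\<lambda>x. (\<alpha> x)\<^sup>2) y)" for n
    by (rule dom', simp)+
  show "integrable Q (\<lambda>y. (cond \<alpha> y)\<^sup>2)"
    by (rule Q_integrable_dominated[OF bd _ cond_square_integrable[OF \<alpha>]]) measurable
  have W: "integrable Q (cond (\<lambda>x. (\<alpha> x)\<^sup>2))"
    by (rule Q_integrable_dominated[OF bd _ cond_integrable[OF _ i]]) measurable
  have "AE y in Q. (max \<bar>s\<bar> \<bar>t\<bar>)\<^sup>2 * cond (\<lambda>x. (\<alpha> x)\<^sup>2) y = (max \<bar>s\<bar> \<bar>t\<bar> * sqrt (cond (\<lambda>x. (\<alpha> x)\<^sup>2) y))\<^sup>2"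
    using nonneg by eventually_elim (simp add: power_mult_distrib)
  from integrable_cong_AE[OF _ _ this] W
  show "integrable Q (\<lambda>y. (max \<bar>s\<bar> \<bar>t\<bar> * sqrt (cond (\<lambda>x. (\<alpha> x)\<^sup>2) y))\<^sup>2)"
    by simp
qed

text \<open>
  Tilting \<open>f\<close> by \<open>k (h)\<close> tilts the marginal \<open>f\<^sub>S\<close> by the conditional mean \<open>K\<close> of \<open>k (h)\<close>. All
  normalising constants, that of the perturbed density and those of \<open>r\<^sub>S\<close> before and after the
  tilt, combine into the mean of \<open>K\<close> under \<open>Q\<close>.
\<close>

lemma sqrt_density_partial_law:
  assumes [measurable]: "h \<in> borel_measurable (Leb {1..d})"
  defines "K \<equiv> cond (\<lambda>x. kfun (h x))"
  shows "sqrt_density Q (partial_law d r S (perturbed d f h)) (\<lambda>y. sqrt (K y / integral\<^sup>L Q K))"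
proof -
  interpret Q: prob_space Q by (rule Q_prob_space)
  let ?k = "\<lambda>x. kfun (h x) * f x"
  have [measurable]: "K \<in> borel_measurable (Leb S)" unfolding K_def by measurable
  have Kb: "AE y in Q. 1 / 2 \<le> K y \<and> K y \<le> 3 / 2"
    unfolding K_def by (intro AE_QI AE_cond_bounds kfun_bounds) measurable
  have Ki: "integrable Q K"
    by (rule Q.integrable_const_bound[of _ "3/2"], use Kb in eventually_elim) auto
  have "(\<integral>y. 1 / 2 \<partial>Q) \<le> integral\<^sup>L Q K"
    by (rule integral_mono_AE[OF _ Ki], simp, use Kb in eventually_elim) auto
  then have Kpos: "0 < integral\<^sup>L Q K" using Q.prob_space by simp
  have K_nonneg: "0 \<le> K y" if "y \<in> space (Leb S)" for y
    using that f_nonneg kfun_pos fS_nonneg unfolding K_def cond_def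
    by (intro divide_nonneg_nonneg marginal_nonneg) (auto simp: less_imp_le)
  define Z where "Z = integral\<^sup>L (Leb {1..d}) ?k"
  have kabs: "\<bar>kfun (h x)\<bar> \<le> 3 / 2" for x using kfun_bounds[of "h x"] by linarith
  have kf_int: "integrable (Leb {1..d}) ?k"
    by (rule bounded_weight_integrable[OF _ kabs]) measurable
  have "(\<integral>x. 1 / 2 * f x \<partial>Leb {1..d}) \<le> Z"
    unfolding Z_def using f_integrable kf_int kfun_bounds f_nonneg by (intro integral_mono mult_right_mono) auto
  then have Zpos: "0 < Z" by (simp add: f_integral)
  have marg: "marginal d S (perturbed d f h) y = marginal d S ?k y / Z" for y
    unfolding marginal_def perturbed_def Z_def by simp
  define R where "R = (\<integral>y. r S y * marginal d S ?k y \<partial>Leb S)"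
  have dens: "normalised d r S (perturbed d f h) y * marginal d S (perturbed d f h) y = r S y * marginal d S ?k y / R" for y
    unfolding normalised_def marg R_def using Zpos by simp
  define c where "c = (\<integral>y. r S y * fS y \<partial>Leb S)"
  have cpos: "0 < c" unfolding c_def by (rule r_mean_pos)
  have ae: "AE y in Leb S. K y * fS y = marginal d S ?k y"
    unfolding K_def by (rule AE_cond_mult) measurable
  have EK: "integral\<^sup>L Q K = R / c"
  proof -
    have "integral\<^sup>L Q K = (\<integral>y. rbar y * K y * fS y \<partial>Leb S)" by (simp add: Q_integral)
    also have "\<dots> = (\<integral>y. r S y * marginal d S ?k y / c \<partial>Leb S)"
    proof (rule integral_cong_AE)
      show "AE y in Leb S. rbar y * K y * fS y = r S y * marginal d S ?k y / c"
        using ae by eventually_elim (simp add: normalised_def c_def mult.assoc)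
    qed measurable
    finally show ?thesis by (simp add: R_def)
  qed
  have P: "partial_law d r S (perturbed d f h) = density Q (\<lambda>y. ennreal ((sqrt (K y / integral\<^sup>L Q K))\<^sup>2))"
  proof -
    have "density Q (\<lambda>y. ennreal ((sqrt (K y / integral\<^sup>L Q K))\<^sup>2))
        = density (Leb S) (\<lambda>y. ennreal (rbar y * fS y) * ennreal ((sqrt (K y / integral\<^sup>L Q K))\<^sup>2))"
      unfolding partial_law_def by (rule density_density_eq) measurable
    also have "\<dots> = density (Leb S) (\<lambda>y. ennreal (r S y * marginal d S ?k y / R))"
    proof (rule density_cong)
      show "AE y in Leb S. ennreal (rbar y * fS y) * ennreal ((sqrt (K y / integral\<^sup>L Q K))\<^sup>2)
          = ennreal (r S y * marginal d S ?k y / R)"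
        using ae AE_space
      proof eventually_elim
        case (elim y)
        have "0 \<le> K y / integral\<^sup>L Q K" using K_nonneg[OF elim(2)] Kpos by simp
        then have "ennreal (rbar y * fS y) * ennreal ((sqrt (K y / integral\<^sup>L Q K))\<^sup>2)
           = ennreal (rbar y * fS y * (K y / integral\<^sup>L Q K))"
          using ennreal_mult[OF rbar_fS_nonneg[OF elim(2)]] by (simp only: real_sqrt_pow2)
        also have "rbar y * fS y * (K y / integral\<^sup>L Q K) = r S y / c * (K y * fS y) / (R / c)"
          unfolding EK by (simp add: normalised_def c_def)
        also have "\<dots> = r S y * marginal d S ?k y / R"
          unfolding elim(1) using cpos by simp
        finally show ?case .
      qed
    qed measurable
    finally show ?thesis unfolding partial_law_def[of d r S "perturbed d f h"] dens by simp
  qed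
  have "prob_space (density Q (\<lambda>y. ennreal ((sqrt (K y / integral\<^sup>L Q K))\<^sup>2)))"
  proof
    let ?D = "density Q (\<lambda>y. ennreal ((sqrt (K y / integral\<^sup>L Q K))\<^sup>2))"
    have "emeasure ?D (space ?D) = (\<integral>\<^sup>+y. ennreal ((sqrt (K y / integral\<^sup>L Q K))\<^sup>2) \<partial>Q)"
      by (auto simp: emeasure_density intro!: nn_integral_cong)
    also have "\<dots> = (\<integral>\<^sup>+y. ennreal (K y / integral\<^sup>L Q K) \<partial>Q)"
      using K_nonneg Kpos by (intro nn_integral_cong) simp
    also have "\<dots> = ennreal (\<integral>y. K y / integral\<^sup>L Q K \<partial>Q)"
      using K_nonneg Kpos Ki by (intro nn_integral_eq_integral) auto
    finally show "emeasure ?D (space ?D) = 1" using Kpos by simp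
  qed
  with P show ?thesis
    unfolding sqrt_density_def using Q_prob_space K_nonneg Kpos by (auto simp: real_sqrt_ge_zero)
qed

end

section \<open>The complete sample\<close>

lemma L2_law:
  assumes f: "prob_density d f"
  shows "\<alpha> \<in> L2 d f \<longleftrightarrow> \<alpha> \<in> borel_measurable (Leb {1..d}) \<and> integrable (law d f) (\<lambda>x. (\<alpha> x)\<^sup>2)"
  by (auto simp: L2_def law_integral[OF f])

lemma sqrt_density_law:
  assumes f: "prob_density d f" and [measurable]: "h \<in> borel_measurable (Leb {1..d})"
  defines "Z \<equiv> (\<integral>x. kfun (h x) \<partial>law d f)"
  shows "sqrt_density (law d f) (law d (perturbed d f h)) (\<lambda>x. sqrt (kfun (h x) / Z))" and "0 < Z"
proof -
  note [measurable] = prob_densityD(1)[OF f] and nn = prob_densityD(2)[OF f]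
  interpret prob_space "law d f" by (rule law_prob_space[OF f])
  have k: "\<bar>kfun u\<bar> \<le> 3 / 2" for u using kfun_bounds[of u] by linarith
  have ki: "integrable (law d f) (\<lambda>x. kfun (h x))"
    by (rule integrable_const_bound[of _ "3/2"]) (use k in simp_all)
  have "(\<integral>x. 1 / 2 \<partial>law d f) \<le> Z"
    unfolding Z_def by (rule integral_mono[OF _ ki]) (use kfun_bounds in simp_all)
  then show Z: "0 < Z" using prob_space by simp
  have Z': "Z = (\<integral>z. kfun (h z) * f z \<partial>Leb {1..d})"
    unfolding Z_def by (simp add: law_integral[OF f])
  have sq: "(sqrt (kfun (h x) / Z))\<^sup>2 = kfun (h x) / Z" for x
    using Z kfun_pos[of "h x"] by simp
  have kp: "0 \<le> kfun u" for u using kfun_pos[of u] by simp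
  have P: "law d (perturbed d f h) = density (law d f) (\<lambda>x. ennreal ((sqrt (kfun (h x) / Z))\<^sup>2))"
  proof -
    have "density (law d f) (\<lambda>x. ennreal ((sqrt (kfun (h x) / Z))\<^sup>2))
       = density (Leb {1..d}) (\<lambda>x. ennreal (f x) * ennreal (kfun (h x) / Z))"
      unfolding law_def sq by (rule density_density_eq) measurable
    also have "\<dots> = law d (perturbed d f h)"
      unfolding law_def perturbed_def Z'[symmetric]
    proof (rule density_cong)
      show "AE x in Leb {1..d}. ennreal (f x) * ennreal (kfun (h x) / Z) = ennreal (kfun (h x) * f x / Z)"
      proof (rule AE_I2)
        fix x assume "x \<in> space (Leb {1..d})"
        then show "ennreal (f x) * ennreal (kfun (h x) / Z) = ennreal (kfun (h x) * f x / Z)"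
          using nn[of x] Z kp[of "h x"] by (simp add: ennreal_mult[symmetric] mult.commute)
      qed
    qed measurable
    finally show ?thesis ..
  qed
  have "emeasure (density (law d f) (\<lambda>x. ennreal ((sqrt (kfun (h x) / Z))\<^sup>2))) (space (law d f))
      = (\<integral>\<^sup>+x. ennreal (kfun (h x) / Z) \<partial>law d f)"
    unfolding sq by (auto simp: emeasure_density intro!: nn_integral_cong)
  also have "\<dots> = ennreal (\<integral>x. kfun (h x) / Z \<partial>law d f)"
    using Z kp ki by (intro nn_integral_eq_integral) auto
  also have "(\<integral>x. kfun (h x) / Z \<partial>law d f) = 1" using Z by (simp add: Z_def)
  finally have "prob_space (density (law d f) (\<lambda>x. ennreal ((sqrt (kfun (h x) / Z))\<^sup>2)))"
    by (intro prob_spaceI) simp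
  then show "sqrt_density (law d f) (law d (perturbed d f h)) (\<lambda>x. sqrt (kfun (h x) / Z))"
    unfolding sqrt_density_def using P prob_space_axioms kp Z by (simp add: real_sqrt_ge_zero)
qed

lemma full_affinity_limit:
  assumes f: "prob_density d f" and \<alpha>: "\<alpha> \<in> L2 d f"
  defines "K \<equiv> \<lambda>n t x. kfun (real n powr (- 1 / 2) * t * \<alpha> x)"
  shows "(\<lambda>n. real n * (1 - (\<integral>x. sqrt (K n s x / integral\<^sup>L (law d f) (K n s)) * sqrt (K n t x / integral\<^sup>L (law d f) (K n t)) \<partial>law d f)))
     \<longlonglongrightarrow> (s - t)\<^sup>2 * ((\<integral>x. (\<alpha> x)\<^sup>2 \<partial>law d f) - (\<integral>x. \<alpha> x \<partial>law d f)\<^sup>2) / 8"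
proof (rule affinity_limit[where G = "\<lambda>x. max \<bar>s\<bar> \<bar>t\<bar> * \<bar>\<alpha> x\<bar>"])
  have [measurable]: "\<alpha> \<in> borel_measurable (Leb {1..d})" and i: "integrable (law d f) (\<lambda>x. (\<alpha> x)\<^sup>2)"
    using \<alpha> by (auto simp: L2_law[OF f])
  show "prob_space (law d f)" by (rule law_prob_space[OF f])
  show "K n s \<in> borel_measurable (law d f)" "K n t \<in> borel_measurable (law d f)" for n
    unfolding K_def by measurable
  show "\<alpha> \<in> borel_measurable (law d f)" "(\<lambda>x. max \<bar>s\<bar> \<bar>t\<bar> * \<bar>\<alpha> x\<bar>) \<in> borel_measurable (law d f)" by measurable
  have bds: "AE x in law d f. 1 / 2 \<le> K n t x \<and> K n t x \<le> 3 / 2" for n t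
    unfolding K_def using kfun_bounds by (intro AE_I2) simp
  show "AE x in law d f. 1 / 2 \<le> K n s x \<and> K n s x \<le> 3 / 2" "AE x in law d f. 1 / 2 \<le> K n t x \<and> K n t x \<le> 3 / 2" for n
    by (rule bds)+
  have lim: "AE x in law d f. (\<lambda>n. sqrt (real n) * (K n t x - 1)) \<longlonglongrightarrow> t * \<alpha> x" for t
    unfolding K_def mult.assoc by (intro AE_I2 kfun_local_linearisation)
  show "AE x in law d f. (\<lambda>n. sqrt (real n) * (K n s x - 1)) \<longlonglongrightarrow> s * \<alpha> x"
    "AE x in law d f. (\<lambda>n. sqrt (real n) * (K n t x - 1)) \<longlonglongrightarrow> t * \<alpha> x" by (rule lim)+
  have dom: "AE x in law d f. \<bar>sqrt (real n) * (K n u x - 1)\<bar> \<le> max \<bar>s\<bar> \<bar>t\<bar> * \<bar>\<alpha> x\<bar>"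
    if "\<bar>u\<bar> \<le> max \<bar>s\<bar> \<bar>t\<bar>" for n u
  proof (rule AE_I2)
    fix x
    have "\<bar>sqrt (real n) * (K n u x - 1)\<bar> \<le> \<bar>u * \<alpha> x\<bar>"
      unfolding K_def mult.assoc by (rule kfun_local_bound)
    also have "\<dots> \<le> max \<bar>s\<bar> \<bar>t\<bar> * \<bar>\<alpha> x\<bar>"
      unfolding abs_mult using that by (rule mult_right_mono) simp
    finally show "\<bar>sqrt (real n) * (K n u x - 1)\<bar> \<le> max \<bar>s\<bar> \<bar>t\<bar> * \<bar>\<alpha> x\<bar>" .
  qed
  show "AE x in law d f. \<bar>sqrt (real n) * (K n s x - 1)\<bar> \<le> max \<bar>s\<bar> \<bar>t\<bar> * \<bar>\<alpha> x\<bar>"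
    "AE x in law d f. \<bar>sqrt (real n) * (K n t x - 1)\<bar> \<le> max \<bar>s\<bar> \<bar>t\<bar> * \<bar>\<alpha> x\<bar>" for n
    by (rule dom, simp)+
  show "integrable (law d f) (\<lambda>x. (\<alpha> x)\<^sup>2)" by (rule i)
  show "integrable (law d f) (\<lambda>x. (max \<bar>s\<bar> \<bar>t\<bar> * \<bar>\<alpha> x\<bar>)\<^sup>2)" using i by (simp add: power_mult_distrib)
qed

text \<open>
  \<open>\<theta>(f\<^sub>h)\<close> is the quotient \<open>E(a k(h)) / E k(h)\<close>. Since \<open>\<alpha>\<close> is centred, the denominator is 1 up to
  terms of smaller order than \<open>n\<^bsup>-1/2\<^esup>\<close>, and only the numerator contributes to the derivative.
\<close>

lemma theta_local_limit:
  assumes f: "prob_density d f" and \<alpha>: "\<alpha> \<in> L2 d f" and a: "a \<in> L2 d f"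
    and centred: "(\<integral>x. \<alpha> x \<partial>law d f) = 0"
  shows "(\<lambda>n. sqrt (real n) * (theta d a (perturbed d f (\<lambda>x. real n powr (- 1 / 2) * t * \<alpha> x)) - theta d a f))
     \<longlonglongrightarrow> t * (\<integral>x. a x * \<alpha> x \<partial>law d f)"
proof -
  let ?M = "law d f"
  interpret prob_space ?M by (rule law_prob_space[OF f])
  note [measurable] = prob_densityD(1)[OF f]
  have [measurable]: "\<alpha> \<in> borel_measurable (Leb {1..d})" and i: "integrable ?M (\<lambda>x. (\<alpha> x)\<^sup>2)"
    using \<alpha> by (auto simp: L2_law[OF f])
  have [measurable]: "a \<in> borel_measurable (Leb {1..d})" and a2: "integrable ?M (\<lambda>x. (a x)\<^sup>2)"
    using a by (auto simp: L2_law[OF f])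
  define K where "K n x = kfun (real n powr (- 1 / 2) * t * \<alpha> x)" for n x
  have [measurable]: "K n \<in> borel_measurable (Leb {1..d})" for n unfolding K_def by measurable
  have kb: "\<bar>K n x\<bar> \<le> 3 / 2" for n x
    using kfun_bounds[of "real n powr (- 1 / 2) * t * \<alpha> x"] unfolding K_def by linarith
  define Z where "Z n = integral\<^sup>L ?M (K n)" for n
  have Zpos: "0 < Z n" for n unfolding Z_def K_def by (rule sqrt_density_law(2)[OF f]) measurable
  have a1: "integrable ?M a" by (rule square_integrable_imp_integrable[OF _ a2]) simp
  have ki: "integrable ?M (K n)" for n
    by (rule integrable_const_bound[of _ "3/2"]) (use kb in simp_all)
  have aki: "integrable ?M (\<lambda>x. a x * K n x)" for n
  proof (rule Bochner_Integration.integrable_bound[of _ "\<lambda>x. 3 / 2 * a x"])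
    show "AE x in ?M. norm (a x * K n x) \<le> norm (3 / 2 * a x)"
      using mult_left_mono[OF kb, of "\<bar>a _\<bar>"] by (intro AE_I2) (simp add: abs_mult mult.commute)
  qed (use a1 in simp_all)
  have th: "theta d a f = integral\<^sup>L ?M a" by (simp add: theta_def law_integral[OF f])
  have thn: "theta d a (perturbed d f (\<lambda>x. real n powr (- 1 / 2) * t * \<alpha> x)) = (\<integral>x. a x * K n x \<partial>?M) / Z n" for n
    unfolding theta_def perturbed_def Z_def K_def[symmetric] by (simp add: law_integral[OF f] mult.assoc)
  have gen: "(\<lambda>n. sqrt (real n) * ((\<integral>x. g x * K n x \<partial>?M) - integral\<^sup>L ?M g)) \<longlonglongrightarrow> t * (\<integral>x. g x * \<alpha> x \<partial>?M)"
    if [measurable]: "g \<in> borel_measurable (Leb {1..d})" and g2: "integrable ?M (\<lambda>x. (g x)\<^sup>2)"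
      and gk: "\<And>n. integrable ?M (\<lambda>x. g x * K n x)" for g
  proof -
    have g1: "integrable ?M g" by (rule square_integrable_imp_integrable[OF _ g2]) simp
    have ga: "integrable ?M (\<lambda>x. g x * \<alpha> x)" by (rule integrable_mult_of_squares[OF _ _ g2 i]) simp_all
    have "(\<lambda>n. \<integral>x. g x * (sqrt (real n) * (K n x - 1)) \<partial>?M) \<longlonglongrightarrow> (\<integral>x. g x * (t * \<alpha> x) \<partial>?M)"
    proof (rule integral_dominated_convergence[where w = "\<lambda>x. \<bar>t\<bar> * \<bar>g x * \<alpha> x\<bar>"])
      show "AE x in ?M. (\<lambda>n. g x * (sqrt (real n) * (K n x - 1))) \<longlonglongrightarrow> g x * (t * \<alpha> x)"
        unfolding K_def mult.assoc[of _ t] by (intro AE_I2 tendsto_mult tendsto_const kfun_local_linearisation)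
      show "AE x in ?M. norm (g x * (sqrt (real n) * (K n x - 1))) \<le> \<bar>t\<bar> * \<bar>g x * \<alpha> x\<bar>" for n
      proof (rule AE_I2)
        fix x
        have "\<bar>g x\<bar> * \<bar>sqrt (real n) * (K n x - 1)\<bar> \<le> \<bar>g x\<bar> * \<bar>t * \<alpha> x\<bar>"
          unfolding K_def mult.assoc[of _ t] by (intro mult_left_mono kfun_local_bound) simp
        then show "norm (g x * (sqrt (real n) * (K n x - 1))) \<le> \<bar>t\<bar> * \<bar>g x * \<alpha> x\<bar>"
          by (simp add: abs_mult mult.left_commute)
      qed
    qed (use ga in simp_all)
    moreover have "(\<integral>x. g x * (sqrt (real n) * (K n x - 1)) \<partial>?M) = sqrt (real n) * ((\<integral>x. g x * K n x \<partial>?M) - integral\<^sup>L ?M g)" for n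
    proof -
      have "(\<lambda>x. g x * (sqrt (real n) * (K n x - 1))) = (\<lambda>x. sqrt (real n) * (g x * K n x - g x))"
        by (simp add: algebra_simps)
      then show ?thesis using gk[of n] g1 by simp
    qed
    moreover have "(\<integral>x. g x * (t * \<alpha> x) \<partial>?M) = t * (\<integral>x. g x * \<alpha> x \<partial>?M)"
      by (simp add: mult.left_commute)
    ultimately show ?thesis by simp
  qed
  have l1: "(\<lambda>n. sqrt (real n) * ((\<integral>x. a x * K n x \<partial>?M) - integral\<^sup>L ?M a)) \<longlonglongrightarrow> t * (\<integral>x. a x * \<alpha> x \<partial>?M)"
    by (rule gen[OF _ a2 aki]) simp
  have l2: "(\<lambda>n. sqrt (real n) * (Z n - 1)) \<longlonglongrightarrow> 0"
    using gen[of "\<lambda>_. 1"] ki centred prob_space by (simp add: Z_def)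
  have "(\<lambda>n. (sqrt (real n) * ((\<integral>x. a x * K n x \<partial>?M) - integral\<^sup>L ?M a) - integral\<^sup>L ?M a * (sqrt (real n) * (Z n - 1))) / Z n)
     \<longlonglongrightarrow> (t * (\<integral>x. a x * \<alpha> x \<partial>?M) - integral\<^sup>L ?M a * 0) / 1"
    by (intro tendsto_intros l1 l2 tendsto_of_scaled[OF l2]) simp
  moreover have "(sqrt (real n) * ((\<integral>x. a x * K n x \<partial>?M) - integral\<^sup>L ?M a) - integral\<^sup>L ?M a * (sqrt (real n) * (Z n - 1))) / Z n
     = sqrt (real n) * (theta d a (perturbed d f (\<lambda>x. real n powr (- 1 / 2) * t * \<alpha> x)) - theta d a f)" for n
    unfolding thn th using Zpos[of n] by (simp add: field_simps)
  ultimately show ?thesis by simp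
qed

section \<open>The minimiser and its information\<close>

text \<open>
  At \<open>e = - p / (1 + \<bar>q\<bar>)\<close> the polynomial is at most \<open>- e\<^sup>2\<close>.
\<close>

lemma linear_coefficient_zero:
  fixes p q :: real
  assumes "\<And>e. 0 \<le> p * e + q * e\<^sup>2"
  shows "p = 0"
proof (rule ccontr)
  assume p: "p \<noteq> 0"
  define e where "e = - p / (1 + \<bar>q\<bar>)"
  have "p * e + q * e\<^sup>2 \<le> p * e + \<bar>q\<bar> * e\<^sup>2" by (simp add: mult_right_mono)
  also have "\<dots> = - p\<^sup>2 / (1 + \<bar>q\<bar>)\<^sup>2"
  proof -
    have "p * (- p / m) + (m - 1) * (- p / m)\<^sup>2 = - p\<^sup>2 / m\<^sup>2" if "m \<noteq> 0" for m :: real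
      using that by (simp add: field_simps power2_eq_square)
    from this[of "1 + \<bar>q\<bar>"] show ?thesis unfolding e_def by simp
  qed
  also have "\<dots> < 0" using p by (intro divide_neg_pos) (simp_all add: add_pos_nonneg)
  finally show False using assms[of e] by linarith
qed

locale missing_data_model =
  fixes d :: nat and f a :: "point \<Rightarrow> real" and SS :: "nat set set"
    and r :: "nat set \<Rightarrow> point \<Rightarrow> real" and lam :: "nat set \<Rightarrow> real"
  assumes f: "prob_density d f"
    and SS_sub: "SS \<subseteq> Pow {1..d}"
    and r_measurable: "\<And>S. S \<in> SS \<Longrightarrow> r S \<in> borel_measurable (Leb S)"
    and r_pos: "\<And>S y. S \<in> SS \<Longrightarrow> y \<in> space (Leb S) \<Longrightarrow> r S y > 0"
    and r_integrable: "\<And>S. S \<in> SS \<Longrightarrow> integrable (Leb S) (\<lambda>y. r S y * marginal d S f y)"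
    and r_bounded: "\<And>S. S \<in> SS \<Longrightarrow>
           \<exists>C. AE y in density (Leb S) (\<lambda>y. ennreal (marginal d S f y)). normalised d r S f y \<le> C"
    and a_L2: "a \<in> L2 d f"
    and lam_pos: "\<And>S. S \<in> SS \<Longrightarrow> lam S > 0"
begin

abbreviation "P \<equiv> law d f"

text \<open>
  The weight of \<open>\<alpha>\<^sub>S\<^sup>2\<close> in the objective, as a function on the full space.
\<close>

definition penalty_weight :: "nat set \<Rightarrow> point \<Rightarrow> real" where
  "penalty_weight S x = 1 / (lam S * normalised d r S f (restrict x S))"

definition residual :: "(nat set \<Rightarrow> point \<Rightarrow> real) \<Rightarrow> point \<Rightarrow> real" where
  "residual u = (\<lambda>x. a x - theta d a f - (\<Sum>S\<in>SS. u S x))"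

sublocale P: prob_space P by (rule law_prob_space[OF f])

lemma finite_SS: "finite SS"
  using SS_sub by (rule finite_subset) simp

lemma sample: "S \<in> SS \<Longrightarrow> biased_sample d S f r"
  using f SS_sub r_measurable r_pos r_integrable
  by (auto simp: biased_sample_def biased_sample_axioms_def coordinate_split_def)

lemma penalty_weight_pos: "S \<in> SS \<Longrightarrow> x \<in> space (Leb {1..d}) \<Longrightarrow> 0 < penalty_weight S x"
proof -
  assume S: "S \<in> SS" and x: "x \<in> space (Leb {1..d})"
  interpret B: biased_sample d S f r by (rule sample[OF S])
  have "restrict x S \<in> space (Leb S)" using measurable_space[OF B.restrict_measurable x] .
  then show ?thesis using B.rbar_pos lam_pos[OF S] by (simp add: penalty_weight_def)
qed

lemma penalty_weight_measurable[measurable]: "S \<in> SS \<Longrightarrow> penalty_weight S \<in> borel_measurable (Leb {1..d})"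
proof -
  assume S: "S \<in> SS"
  interpret B: biased_sample d S f r by (rule sample[OF S])
  show ?thesis unfolding penalty_weight_def[abs_def]
    by (intro borel_measurable_divide borel_measurable_times borel_measurable_const
        measurable_compose[OF B.restrict_measurable B.rbar_measurable])
qed

lemma HD:
  assumes "\<beta> \<in> H d f S"
  shows "\<beta> \<in> borel_measurable (Leb {1..d})" "integrable P (\<lambda>x. (\<beta> x)\<^sup>2)" "integrable P \<beta>" "integral\<^sup>L P \<beta> = 0"
    "\<exists>b\<in>borel_measurable (Leb S). \<forall>x\<in>space (Leb {1..d}). \<beta> x = b (restrict x S)"
proof -
  show m[measurable]: "\<beta> \<in> borel_measurable (Leb {1..d})" and i: "integrable P (\<lambda>x. (\<beta> x)\<^sup>2)"
    using assms by (auto simp: H_def L2_law[OF f])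
  show "integrable P \<beta>" by (rule P.square_integrable_imp_integrable[OF _ i]) simp
  show "integral\<^sup>L P \<beta> = 0" "\<exists>b\<in>borel_measurable (Leb S). \<forall>x\<in>space (Leb {1..d}). \<beta> x = b (restrict x S)"
    using assms by (auto simp: H_def law_integral[OF f])
qed

lemma HI:
  assumes "\<beta> \<in> borel_measurable (Leb {1..d})" "integrable P (\<lambda>x. (\<beta> x)\<^sup>2)" "integral\<^sup>L P \<beta> = 0"
    and "b \<in> borel_measurable (Leb S)" "\<And>x. x \<in> space (Leb {1..d}) \<Longrightarrow> \<beta> x = b (restrict x S)"
  shows "\<beta> \<in> H d f S"
  using assms by (auto simp: H_def L2_law[OF f] law_integral[OF f])

lemma square_integrable_lincomb:
  fixes u v :: "point \<Rightarrow> real"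
  assumes [measurable]: "u \<in> borel_measurable (Leb {1..d})" "v \<in> borel_measurable (Leb {1..d})"
    and "integrable P (\<lambda>x. (u x)\<^sup>2)" "integrable P (\<lambda>x. (v x)\<^sup>2)"
  shows "integrable P (\<lambda>x. (u x + c * v x)\<^sup>2)"
proof -
  have "integrable P (\<lambda>x. u x * v x)" by (rule integrable_mult_of_squares) (use assms in simp_all)
  moreover have "(\<lambda>x. (u x + c * v x)\<^sup>2) = (\<lambda>x. (u x)\<^sup>2 + 2 * c * (u x * v x) + c\<^sup>2 * (v x)\<^sup>2)"
    by (auto simp: power2_eq_square algebra_simps)
  ultimately show ?thesis using assms by simp
qed

lemma H_add_scale:
  assumes u: "u \<in> H d f S" and v: "v \<in> H d f S"
  shows "(\<lambda>x. u x + c * v x) \<in> H d f S"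
proof -
  obtain bu bv where b[measurable]: "bu \<in> borel_measurable (Leb S)" "bv \<in> borel_measurable (Leb S)"
    and e: "\<And>x. x \<in> space (Leb {1..d}) \<Longrightarrow> u x = bu (restrict x S)" "\<And>x. x \<in> space (Leb {1..d}) \<Longrightarrow> v x = bv (restrict x S)"
    using HD(5)[OF u] HD(5)[OF v] by blast
  note [measurable] = HD(1)[OF u] HD(1)[OF v]
  show ?thesis
  proof (rule HI[where b = "\<lambda>y. bu y + c * bv y"])
    show "integrable P (\<lambda>x. (u x + c * v x)\<^sup>2)"
      by (rule square_integrable_lincomb) (use HD[OF u] HD[OF v] in simp_all)
    show "integral\<^sup>L P (\<lambda>x. u x + c * v x) = 0" using HD[OF u] HD[OF v] by simp
  qed (use e in simp_all)
qed

lemma zero_in_H: "(\<lambda>x. 0) \<in> H d f S"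
  by (rule HI[where b = "\<lambda>_. 0"]) simp_all

lemma a_integrable: "a \<in> borel_measurable (Leb {1..d})" "integrable P (\<lambda>x. (a x)\<^sup>2)" "integrable P a" "integral\<^sup>L P a = theta d a f"
proof -
  show m[measurable]: "a \<in> borel_measurable (Leb {1..d})" and i: "integrable P (\<lambda>x. (a x)\<^sup>2)"
    using a_L2 by (auto simp: L2_law[OF f])
  show "integrable P a" by (rule P.square_integrable_imp_integrable[OF _ i]) simp
  show "integral\<^sup>L P a = theta d a f" by (simp add: theta_def law_integral[OF f])
qed

lemma residual_facts:
  assumes u: "u \<in> Pi SS (H d f)"
  shows "residual u \<in> borel_measurable (Leb {1..d})" "integrable P (\<lambda>x. (residual u x)\<^sup>2)"
    "integrable P (residual u)" "integral\<^sup>L P (residual u) = 0"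
proof -
  have uH: "S \<in> SS \<Longrightarrow> u S \<in> H d f S" for S using u by auto
  have sum_sq: "(\<lambda>x. \<Sum>S\<in>T. u S x) \<in> borel_measurable (Leb {1..d}) \<and> integrable P (\<lambda>x. (\<Sum>S\<in>T. u S x)\<^sup>2)"
    if "finite T" "T \<subseteq> SS" for T
    using that
  proof (induction T)
    case (insert S T)
    then have [measurable]: "u S \<in> borel_measurable (Leb {1..d})" "(\<lambda>x. \<Sum>S\<in>T. u S x) \<in> borel_measurable (Leb {1..d})"
      and "integrable P (\<lambda>x. (u S x)\<^sup>2)" "integrable P (\<lambda>x. (\<Sum>S\<in>T. u S x)\<^sup>2)"
      using HD[OF uH] by auto
    with square_integrable_lincomb[of "u S" "\<lambda>x. \<Sum>S\<in>T. u S x" 1] insert show ?case by simp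
  qed simp
  note [measurable] = a_integrable(1) sum_sq[OF finite_SS subset_refl, THEN conjunct1]
  show m: "residual u \<in> borel_measurable (Leb {1..d})" unfolding residual_def by measurable
  have "integrable P (\<lambda>x. (a x + (- 1) * (\<Sum>S\<in>SS. u S x))\<^sup>2)"
    by (rule square_integrable_lincomb) (use a_integrable sum_sq[OF finite_SS subset_refl] in simp_all)
  from square_integrable_lincomb[OF _ _ this, of "\<lambda>_. 1" "- theta d a f"]
  show i: "integrable P (\<lambda>x. (residual u x)\<^sup>2)"
    by (simp add: residual_def algebra_simps)
  show "integrable P (residual u)" by (rule P.square_integrable_imp_integrable[OF _ i]) (use m in simp)
  have "integrable P (u S)" "integral\<^sup>L P (u S) = 0" if "S \<in> SS" for S using HD[OF uH[OF that]] by auto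
  then show "integral\<^sup>L P (residual u) = 0"
    unfolding residual_def using a_integrable P.prob_space by simp
qed

lemma Lobj_eq:
  assumes u: "u \<in> Pi SS (H d f)"
  shows "Lobj d SS f r lam a u
    = ennreal (\<integral>x. (residual u x)\<^sup>2 \<partial>P) + (\<Sum>S\<in>SS. \<integral>\<^sup>+x. ennreal ((u S x)\<^sup>2 * penalty_weight S x) \<partial>P)"
proof -
  have uH: "S \<in> SS \<Longrightarrow> u S \<in> H d f S" for S using u by auto
  have "integrable P (u S)" "integral\<^sup>L P (u S) = 0" if "S \<in> SS" for S using HD[OF uH[OF that]] by auto
  then have "integral\<^sup>L P (\<lambda>x. a x - (\<Sum>S\<in>SS. u S x)) = theta d a f"
    using a_integrable by simp
  then show ?thesis
    unfolding Lobj_def by (simp add: residual_def penalty_weight_def algebra_simps)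
qed

lemma Lobj_zero_finite: "Lobj d SS f r lam a (\<lambda>_ _. 0) < \<top>"
  by (subst Lobj_eq) (simp_all add: zero_in_H)

context
  fixes u :: "nat set \<Rightarrow> point \<Rightarrow> real"
  assumes min: "is_arg_min (Lobj d SS f r lam a) (\<lambda>\<alpha>. \<alpha> \<in> Pi SS (H d f)) u"
begin

lemma minimiser_H: "S \<in> SS \<Longrightarrow> u S \<in> H d f S" and minimiser_Pi: "u \<in> Pi SS (H d f)"
  and minimiser_le: "v \<in> Pi SS (H d f) \<Longrightarrow> Lobj d SS f r lam a u \<le> Lobj d SS f r lam a v"
  using min by (auto simp: is_arg_min_def not_less)

definition penalty :: "nat set \<Rightarrow> real" where "penalty S = (\<integral>x. (u S x)\<^sup>2 * penalty_weight S x \<partial>P)"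

lemma penalty_integrable:
  assumes S: "S \<in> SS"
  shows "integrable P (\<lambda>x. (u S x)\<^sup>2 * penalty_weight S x)" "(\<integral>\<^sup>+x. ennreal ((u S x)\<^sup>2 * penalty_weight S x) \<partial>P) = ennreal (penalty S)" "0 \<le> penalty S"
proof -
  note [measurable] = HD(1)[OF minimiser_H[OF S]] penalty_weight_measurable[OF S]
  have nn: "AE x in P. 0 \<le> (u S x)\<^sup>2 * penalty_weight S x" using penalty_weight_pos[OF S] by (intro AE_I2) (simp add: less_imp_le)
  have "Lobj d SS f r lam a u < \<top>"
    using minimiser_le[of "\<lambda>_ _. 0"] Lobj_zero_finite by (simp add: zero_in_H)
  then have "(\<Sum>S\<in>SS. \<integral>\<^sup>+x. ennreal ((u S x)\<^sup>2 * penalty_weight S x) \<partial>P) < \<top>"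
    unfolding Lobj_eq[OF minimiser_Pi] by (simp add: less_top)
  moreover have "(\<integral>\<^sup>+x. ennreal ((u S x)\<^sup>2 * penalty_weight S x) \<partial>P) \<le> (\<Sum>S\<in>SS. \<integral>\<^sup>+x. ennreal ((u S x)\<^sup>2 * penalty_weight S x) \<partial>P)"
    using S finite_SS by (intro member_le_sum) auto
  ultimately have "(\<integral>\<^sup>+x. ennreal ((u S x)\<^sup>2 * penalty_weight S x) \<partial>P) < \<top>" by (rule le_less_trans[rotated])
  then show i: "integrable P (\<lambda>x. (u S x)\<^sup>2 * penalty_weight S x)"
    using nn by (intro integrableI_nonneg) simp_all
  show "(\<integral>\<^sup>+x. ennreal ((u S x)\<^sup>2 * penalty_weight S x) \<partial>P) = ennreal (penalty S)"
    unfolding penalty_def by (rule nn_integral_eq_integral[OF i nn])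
  show "0 \<le> penalty S" unfolding penalty_def by (rule integral_nonneg_AE[OF nn])
qed

lemma minimum_value:
  "Lobj d SS f r lam a u = ennreal ((\<integral>x. (residual u x)\<^sup>2 \<partial>P) + (\<Sum>S\<in>SS. penalty S))"
  unfolding Lobj_eq[OF minimiser_Pi] using penalty_integrable
  by (simp add: sum_ennreal sum_nonneg)

text \<open>
  Along the line \<open>u\<^sub>S + e \<beta>\<close> the objective is a quadratic polynomial in \<open>e\<close> with finite
  coefficients and has its minimum at 0, so its linear coefficient vanishes.
\<close>

lemma first_order_condition:
  assumes S: "S \<in> SS" and \<beta>: "\<beta> \<in> H d f S" and fin: "integrable P (\<lambda>x. (\<beta> x)\<^sup>2 * penalty_weight S x)"
  shows "(\<integral>x. residual u x * \<beta> x \<partial>P) = (\<integral>x. u S x * \<beta> x * penalty_weight S x \<partial>P)"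
proof -
  note [measurable] = HD(1)[OF minimiser_H[OF S]] HD(1)[OF \<beta>] penalty_weight_measurable[OF S] residual_facts(1)[OF minimiser_Pi]
  have wnn: "x \<in> space P \<Longrightarrow> 0 \<le> penalty_weight S x" for x using penalty_weight_pos[OF S, of x] by simp
  have "integrable P (\<lambda>x. (u S x * sqrt (penalty_weight S x)) * (\<beta> x * sqrt (penalty_weight S x)))"
  proof (rule integrable_mult_of_squares)
    have "integrable P (\<lambda>x. (g x * sqrt (penalty_weight S x))\<^sup>2) \<longleftrightarrow> integrable P (\<lambda>x. (g x)\<^sup>2 * penalty_weight S x)" for g :: "point \<Rightarrow> real"
      using wnn by (intro Bochner_Integration.integrable_cong) (simp_all add: power_mult_distrib)
    then show "integrable P (\<lambda>x. (u S x * sqrt (penalty_weight S x))\<^sup>2)" "integrable P (\<lambda>x. (\<beta> x * sqrt (penalty_weight S x))\<^sup>2)"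
      using penalty_integrable(1)[OF S] fin by simp_all
  qed simp_all
  also have "integrable P (\<lambda>x. (u S x * sqrt (penalty_weight S x)) * (\<beta> x * sqrt (penalty_weight S x))) \<longleftrightarrow> integrable P (\<lambda>x. u S x * \<beta> x * penalty_weight S x)"
    using wnn by (intro Bochner_Integration.integrable_cong) simp_all
  finally have cross: "integrable P (\<lambda>x. u S x * \<beta> x * penalty_weight S x)" .
  have rb: "integrable P (\<lambda>x. residual u x * \<beta> x)"
    by (rule integrable_mult_of_squares) (use residual_facts[OF minimiser_Pi] HD[OF \<beta>] in simp_all)
  define rest where "rest = (\<Sum>T\<in>SS - {S}. penalty T)"
  have rest: "0 \<le> rest" unfolding rest_def using penalty_integrable(3) by (intro sum_nonneg) auto
  have "2 * ((\<integral>x. u S x * \<beta> x * penalty_weight S x \<partial>P) - (\<integral>x. residual u x * \<beta> x \<partial>P)) = 0"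
  proof (rule linear_coefficient_zero)
    fix e :: real
    define v where "v = u(S := (\<lambda>x. u S x + e * \<beta> x))"
    have v: "v \<in> Pi SS (H d f)"
      unfolding v_def using minimiser_H H_add_scale[OF minimiser_H[OF S] \<beta>] by auto
    have res: "residual v x = residual u x + (- e) * \<beta> x" for x
      unfolding residual_def using S finite_SS by (simp add: sum.remove[of SS S] v_def algebra_simps)
    have EA: "(\<integral>x. (residual v x)\<^sup>2 \<partial>P)
       = (\<integral>x. (residual u x)\<^sup>2 \<partial>P) - 2 * e * (\<integral>x. residual u x * \<beta> x \<partial>P) + e\<^sup>2 * (\<integral>x. (\<beta> x)\<^sup>2 \<partial>P)"
    proof -
      have "(\<lambda>x. (residual v x)\<^sup>2) = (\<lambda>x. (residual u x)\<^sup>2 - 2 * e * (residual u x * \<beta> x) + e\<^sup>2 * (\<beta> x)\<^sup>2)"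
        unfolding res by (auto simp: power2_eq_square algebra_simps)
      then show ?thesis using rb residual_facts[OF minimiser_Pi] HD[OF \<beta>] by simp
    qed
    have eV: "(\<lambda>x. (v S x)\<^sup>2 * penalty_weight S x) = (\<lambda>x. (u S x)\<^sup>2 * penalty_weight S x + 2 * e * (u S x * \<beta> x * penalty_weight S x) + e\<^sup>2 * ((\<beta> x)\<^sup>2 * penalty_weight S x))"
      unfolding v_def by (auto simp: power2_eq_square algebra_simps)
    have iV: "integrable P (\<lambda>x. (v S x)\<^sup>2 * penalty_weight S x)"
      and EV: "(\<integral>x. (v S x)\<^sup>2 * penalty_weight S x \<partial>P) = penalty S + 2 * e * (\<integral>x. u S x * \<beta> x * penalty_weight S x \<partial>P) + e\<^sup>2 * (\<integral>x. (\<beta> x)\<^sup>2 * penalty_weight S x \<partial>P)"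
      unfolding eV penalty_def using penalty_integrable(1)[OF S] cross fin by simp_all
    have nV: "(\<integral>\<^sup>+x. ennreal ((v S x)\<^sup>2 * penalty_weight S x) \<partial>P) = ennreal (\<integral>x. (v S x)\<^sup>2 * penalty_weight S x \<partial>P)"
      using wnn by (intro nn_integral_eq_integral[OF iV] AE_I2) simp
    have VvS: "0 \<le> (\<integral>x. (v S x)\<^sup>2 * penalty_weight S x \<partial>P)" using wnn by (intro integral_nonneg_AE AE_I2) simp
    have "(\<Sum>T\<in>SS - {S}. \<integral>\<^sup>+x. ennreal ((v T x)\<^sup>2 * penalty_weight T x) \<partial>P) = (\<Sum>T\<in>SS - {S}. ennreal (penalty T))"
      using penalty_integrable(2) by (intro sum.cong) (auto simp: v_def)
    also have "\<dots> = ennreal rest" unfolding rest_def using penalty_integrable(3) by (intro sum_ennreal) auto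
    finally have "Lobj d SS f r lam a v = ennreal ((\<integral>x. (residual v x)\<^sup>2 \<partial>P) + ((\<integral>x. (v S x)\<^sup>2 * penalty_weight S x \<partial>P) + rest))"
      unfolding Lobj_eq[OF v] using S finite_SS rest VvS by (simp add: sum.remove[of SS S] nV)
    moreover have "(\<Sum>T\<in>SS. penalty T) = penalty S + rest"
      using S finite_SS by (simp add: rest_def sum.remove[of SS S])
    ultimately have "ennreal ((\<integral>x. (residual u x)\<^sup>2 \<partial>P) + (penalty S + rest))
       \<le> ennreal ((\<integral>x. (residual v x)\<^sup>2 \<partial>P) + ((\<integral>x. (v S x)\<^sup>2 * penalty_weight S x \<partial>P) + rest))"
      using minimiser_le[OF v] by (simp add: minimum_value)
    then have "(\<integral>x. (residual u x)\<^sup>2 \<partial>P) + (penalty S + rest) \<le> (\<integral>x. (residual v x)\<^sup>2 \<partial>P) + ((\<integral>x. (v S x)\<^sup>2 * penalty_weight S x \<partial>P) + rest)"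
      using VvS rest by (subst (asm) ennreal_le_iff) auto
    then show "0 \<le> 2 * ((\<integral>x. u S x * \<beta> x * penalty_weight S x \<partial>P) - (\<integral>x. residual u x * \<beta> x \<partial>P)) * e
        + ((\<integral>x. (\<beta> x)\<^sup>2 \<partial>P) + (\<integral>x. (\<beta> x)\<^sup>2 * penalty_weight S x \<partial>P)) * e\<^sup>2"
      unfolding EA EV by (simp add: algebra_simps)
  qed
  then show "(\<integral>x. residual u x * \<beta> x \<partial>P) = (\<integral>x. u S x * \<beta> x * penalty_weight S x \<partial>P)" by simp
qed


text \<open>
  The first-order condition tested with \<open>u\<^sub>S\<close> itself gives the second identity. For the first one
  the test function is \<open>\<beta> = rbar (A - c) - u\<^sub>S / \<lambda>\<^sub>S\<close>, where \<open>c\<close> is the mean of \<open>A\<close> under \<open>Q\<close>, that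
  is, \<open>rbar\<close> times the difference of the centred score and the function
  \<open>u\<^sub>S / (\<lambda>\<^sub>S rbar)\<close> that it has to equal. The boundedness of \<open>rbar\<close> makes \<open>\<beta>\<close> square integrable, and the factor \<open>rbar\<close>
  makes its penalty finite. In the resulting equation the left side is the variance of \<open>A\<close> under
  \<open>Q\<close> minus \<open>penalty S / \<lambda>\<^sub>S\<close>, while the two terms of the right side cancel.
\<close>

lemma partial_information:
  assumes S: "S \<in> SS"
  defines "A \<equiv> biased_sample.cond d S f (residual u)" and "Q \<equiv> partial_law d r S f"
  shows "lam S * ((\<integral>y. (A y)\<^sup>2 \<partial>Q) - (\<integral>y. A y \<partial>Q)\<^sup>2) = penalty S"
    and "(\<integral>x. residual u x * u S x \<partial>P) = penalty S"
proof -
  interpret B: biased_sample d S f r by (rule sample[OF S])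
  interpret Q: prob_space Q unfolding Q_def by (rule B.Q_prob_space)
  let ?\<alpha> = "residual u" and ?R = "\<lambda>x. restrict x S"
  note uH = minimiser_H[OF S]
  note \<alpha> = residual_facts[OF minimiser_Pi]
  have \<alpha>L2: "?\<alpha> \<in> L2 d f" using \<alpha> by (simp add: L2_law[OF f])
  note [measurable] = \<alpha>(1) HD(1)[OF uH] penalty_weight_measurable[OF S]
  have [measurable]: "A \<in> borel_measurable (Leb S)" unfolding A_def by measurable
  obtain b where b[measurable]: "b \<in> borel_measurable (Leb S)"
    and ub: "\<And>x. x \<in> space (Leb {1..d}) \<Longrightarrow> u S x = b (?R x)" using HD(5)[OF uH] by blast
  obtain C where C: "AE y in density (Leb S) (\<lambda>y. ennreal (marginal d S f y)). B.rbar y \<le> C"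
    using r_bounded[OF S] by blast
  have l: "lam S \<noteq> 0" using lam_pos[OF S] by simp
  have R_space: "?R x \<in> space (Leb S)" if "x \<in> space (Leb {1..d})" for x
    using measurable_space[OF B.restrict_measurable that] .
  show aV: "(\<integral>x. ?\<alpha> x * u S x \<partial>P) = penalty S"
    using first_order_condition[OF S uH penalty_integrable(1)[OF S]]
    by (simp add: penalty_def power2_eq_square)

  define c where "c = integral\<^sup>L Q A"
  have A2Q: "integrable Q (\<lambda>y. (A y)\<^sup>2)" unfolding A_def Q_def
    by (rule B.Q_integrable_dominated[OF C _ B.cond_square_integrable[OF \<alpha>L2]]) measurable
  have QM: "sets Q = sets (Leb S)" "space Q = space (Leb S)" by (simp_all add: Q_def)
  have [measurable_cong]: "sets Q = sets (Leb S)" by (rule QM)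
  have AQ: "integrable Q A" by (rule Q.square_integrable_imp_integrable[OF _ A2Q]) simp
  have AcQ: "integrable Q (\<lambda>y. (A y - c)\<^sup>2)" and var: "(\<integral>y. (A y - c) * A y \<partial>Q) = (\<integral>y. (A y)\<^sup>2 \<partial>Q) - c\<^sup>2"
  proof -
    have "(\<lambda>y. (A y - c)\<^sup>2) = (\<lambda>y. (A y)\<^sup>2 - 2 * c * A y + c\<^sup>2)" "(\<lambda>y. (A y - c) * A y) = (\<lambda>y. (A y)\<^sup>2 - c * A y)"
      by (auto simp: power2_eq_square algebra_simps)
    then show "integrable Q (\<lambda>y. (A y - c)\<^sup>2)" "(\<integral>y. (A y - c) * A y \<partial>Q) = (\<integral>y. (A y)\<^sup>2 \<partial>Q) - c\<^sup>2"
      using A2Q AQ by (simp_all add: c_def power2_eq_square)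
  qed
  note toP = B.Q_integral_eq_law_integral[folded Q_def]
  define p where "p x = B.rbar (?R x) * (A (?R x) - c)" for x
  have [measurable]: "p \<in> borel_measurable (Leb {1..d})" unfolding p_def by measurable
  have p2w: "integrable P (\<lambda>x. B.rbar (?R x) * (A (?R x) - c)\<^sup>2)"
    using toP(1)[of "\<lambda>y. (A y - c)\<^sup>2"] AcQ by simp
  have "integrable Q (\<lambda>y. B.rbar y * (A y - c)\<^sup>2)"
    unfolding Q_def
  proof (rule B.Q_integrable_dominated[OF C])
    show "integrable (Leb S) (\<lambda>y. B.rbar y * (A y - c)\<^sup>2 * B.fS y)"
      using AcQ unfolding Q_def by (subst (asm) B.Q_integral) simp_all
  qed measurable
  then have p2: "integrable P (\<lambda>x. (p x)\<^sup>2)"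
    using toP(1)[of "\<lambda>y. B.rbar y * (A y - c)\<^sup>2"] by (simp add: p_def power2_eq_square mult_ac)
  have p1: "integral\<^sup>L P p = 0"
  proof -
    have "integral\<^sup>L P p = (\<integral>y. A y - c \<partial>Q)" unfolding p_def by (rule toP(2)[symmetric]) measurable
    also have "\<dots> = 0" using AQ by (simp add: c_def Q.prob_space)
    finally show ?thesis .
  qed
  (* p is centred because c is the mean of A under Q, so the test function is admissible *)
  define \<beta> where "\<beta> x = p x + (- 1 / lam S) * u S x" for x
  have \<beta>H: "\<beta> \<in> H d f S"
  proof (rule HI[where b = "\<lambda>y. B.rbar y * (A y - c) + (- 1 / lam S) * b y"])
    show "\<beta> \<in> borel_measurable (Leb {1..d})" unfolding \<beta>_def by measurable
    show "integrable P (\<lambda>x. (\<beta> x)\<^sup>2)"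
      unfolding \<beta>_def by (rule square_integrable_lincomb) (use p2 HD[OF uH] in simp_all)
    have "integrable P p" by (rule P.square_integrable_imp_integrable[OF _ p2]) simp
    then show "integral\<^sup>L P \<beta> = 0" unfolding \<beta>_def using HD[OF uH] p1 by simp
  qed (use ub in \<open>simp_all add: \<beta>_def p_def\<close>)
  have cA: "integrable P (\<lambda>x. u S x * A (?R x))" "(\<integral>x. u S x * A (?R x) \<partial>P) = penalty S"
  proof -
    have "integrable P (\<lambda>x. u S x * ?\<alpha> x)"
      by (rule integrable_mult_of_squares) (use \<alpha> HD[OF uH] in simp_all)
    then have "integrable P (\<lambda>x. b (?R x) * ?\<alpha> x)"
      by (rule Bochner_Integration.integrable_cong[THEN iffD1, OF refl, rotated]) (simp only: space_law ub)
    note t = B.law_cond_mult[OF \<alpha>(1) b this, folded A_def]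
    show "integrable P (\<lambda>x. u S x * A (?R x))"
      by (rule Bochner_Integration.integrable_cong[THEN iffD1, OF refl _ t(1)]) (simp only: space_law ub)
    have "(\<integral>x. u S x * A (?R x) \<partial>P) = (\<integral>x. b (?R x) * A (?R x) \<partial>P)"
      by (rule Bochner_Integration.integral_cong[OF refl]) (simp only: space_law ub)
    also have "\<dots> = (\<integral>x. ?\<alpha> x * u S x \<partial>P)"
      unfolding t(2) by (rule Bochner_Integration.integral_cong[OF refl]) (simp only: space_law ub mult.commute)
    finally show "(\<integral>x. u S x * A (?R x) \<partial>P) = penalty S" using aV by simp
  qed
  have pw: "p x * penalty_weight S x = (A (?R x) - c) / lam S" if "x \<in> space (Leb {1..d})" for x
    using B.rbar_pos[OF R_space[OF that]] by (simp add: p_def penalty_weight_def)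
  have \<beta>w: "u S x * \<beta> x * penalty_weight S x = (u S x * A (?R x) - c * u S x) / lam S - (u S x)\<^sup>2 * penalty_weight S x / lam S"
    if "x \<in> space (Leb {1..d})" for x
  proof -
    have "u S x * \<beta> x * penalty_weight S x = u S x * (p x * penalty_weight S x) - (u S x)\<^sup>2 * penalty_weight S x / lam S"
      unfolding \<beta>_def by (simp add: power2_eq_square algebra_simps)
    then show ?thesis unfolding pw[OF that] by (simp add: algebra_simps diff_divide_distrib)
  qed
  have \<beta>2w: "(\<beta> x)\<^sup>2 * penalty_weight S x = B.rbar (?R x) * (A (?R x) - c)\<^sup>2 / lam S - 2 / (lam S)\<^sup>2 * (u S x * A (?R x) - c * u S x)
      + (u S x)\<^sup>2 * penalty_weight S x / (lam S)\<^sup>2"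
    if "x \<in> space (Leb {1..d})" for x
  proof -
    have "(\<beta> x)\<^sup>2 * penalty_weight S x = p x * (p x * penalty_weight S x) - 2 / lam S * u S x * (p x * penalty_weight S x) + (u S x)\<^sup>2 * penalty_weight S x / (lam S)\<^sup>2"
      unfolding \<beta>_def using l by (simp add: power2_eq_square field_simps)
    then show ?thesis unfolding pw[OF that]
      by (simp add: p_def power2_eq_square algebra_simps diff_divide_distrib add_divide_distrib)
  qed
  have "integrable P (\<lambda>x. B.rbar (?R x) * (A (?R x) - c)\<^sup>2 / lam S - 2 / (lam S)\<^sup>2 * (u S x * A (?R x) - c * u S x)
      + (u S x)\<^sup>2 * penalty_weight S x / (lam S)\<^sup>2)"
    using p2w cA(1) HD(3)[OF uH] penalty_integrable(1)[OF S] by simp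
  then have fin: "integrable P (\<lambda>x. (\<beta> x)\<^sup>2 * penalty_weight S x)"
    by (rule Bochner_Integration.integrable_cong[THEN iffD1, rotated 2]) (simp_all add: \<beta>2w)
  have "(\<integral>x. ?\<alpha> x * \<beta> x \<partial>P) = (\<integral>x. u S x * \<beta> x * penalty_weight S x \<partial>P)"
    by (rule first_order_condition[OF S \<beta>H fin])
  also have "\<dots> = (\<integral>x. (u S x * A (?R x) - c * u S x) / lam S - (u S x)\<^sup>2 * penalty_weight S x / lam S \<partial>P)"
    by (rule Bochner_Integration.integral_cong) (simp_all add: \<beta>w)
  also have "\<dots> = 0"
    using cA HD[OF uH] penalty_integrable(1)[OF S] by (simp add: penalty_def)
  finally have zero: "(\<integral>x. ?\<alpha> x * \<beta> x \<partial>P) = 0" .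
  have \<alpha>p: "integrable P (\<lambda>x. p x * ?\<alpha> x)"
    by (rule integrable_mult_of_squares) (use \<alpha> p2 in simp_all)
  have "(\<integral>x. p x * ?\<alpha> x \<partial>P) = (\<integral>x. B.rbar (?R x) * (A (?R x) - c) * A (?R x) \<partial>P)"
    using B.law_cond_mult(2)[of ?\<alpha> "\<lambda>y. B.rbar y * (A y - c)", folded A_def] \<alpha>p by (simp add: p_def)
  also have "\<dots> = (\<integral>y. (A y - c) * A y \<partial>Q)"
    using toP(2)[of "\<lambda>y. (A y - c) * A y"] by (simp add: mult.assoc)
  also note var
  finally have \<alpha>pv: "(\<integral>x. p x * ?\<alpha> x \<partial>P) = (\<integral>y. (A y)\<^sup>2 \<partial>Q) - c\<^sup>2" .
  have "(\<lambda>x. ?\<alpha> x * \<beta> x) = (\<lambda>x. p x * ?\<alpha> x - (?\<alpha> x * u S x) / lam S)"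
    unfolding \<beta>_def by (auto simp: algebra_simps)
  moreover have "integrable P (\<lambda>x. ?\<alpha> x * u S x)"
    by (rule integrable_mult_of_squares) (use \<alpha> HD[OF uH] in simp_all)
  ultimately have "(\<integral>x. ?\<alpha> x * \<beta> x \<partial>P) = ((\<integral>y. (A y)\<^sup>2 \<partial>Q) - c\<^sup>2) - penalty S / lam S"
    using \<alpha>p \<alpha>pv aV by simp
  with zero l show "lam S * ((\<integral>y. (A y)\<^sup>2 \<partial>Q) - (\<integral>y. A y \<partial>Q)\<^sup>2) = penalty S"
    unfolding c_def by (simp add: field_simps)
qed

definition information :: real where "information = (\<integral>x. (residual u x)\<^sup>2 \<partial>P) + (\<Sum>S\<in>SS. penalty S)"

lemma information_nonneg: "0 \<le> information"
  unfolding information_def using penalty_integrable(3) by (intro add_nonneg_nonneg sum_nonneg integral_nonneg_AE) auto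

text \<open>
  Write \<open>a = \<alpha> + \<theta> + \<Sum> u\<^sub>S\<close>, where \<open>\<alpha>\<close> is centred and its inner product with \<open>u\<^sub>S\<close> is the penalty of
  \<open>u\<^sub>S\<close>.
\<close>

lemma derivative_eq_information: "(\<integral>x. a x * residual u x \<partial>P) = information"
proof -
  note \<alpha> = residual_facts[OF minimiser_Pi]
  have i: "integrable P (\<lambda>x. residual u x * u S x)" if "S \<in> SS" for S
    by (rule integrable_mult_of_squares) (use \<alpha> HD[OF minimiser_H[OF that]] in simp_all)
  have "(\<lambda>x. a x * residual u x) = (\<lambda>x. (residual u x)\<^sup>2 + theta d a f * residual u x + (\<Sum>S\<in>SS. residual u x * u S x))"
  proof
    fix x
    have ax: "a x = residual u x + theta d a f + (\<Sum>S\<in>SS. u S x)" by (simp add: residual_def)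
    show "a x * residual u x = (residual u x)\<^sup>2 + theta d a f * residual u x + (\<Sum>S\<in>SS. residual u x * u S x)"
      unfolding sum_distrib_left[symmetric] by (subst ax) (simp add: power2_eq_square algebra_simps)
  qed
  then show ?thesis using \<alpha> i partial_information(2) by (simp add: information_def)
qed

end

end

section \<open>The lower bound\<close>

text \<open>
  The limit of the grid bound as the number of grid points grows: the ends of the grid become
  negligible.
\<close>

lemma grid_bound_limit_points:
  fixes j e c g :: real
  shows "(\<lambda>m. (2 * j * e * (real m + 1) - c * (2 + real m * g)) / (real m + 2)) \<longlonglongrightarrow> 2 * j * e - c * g"
proof -
  have "(\<lambda>m. (real m + 1) / (real m + 2)) \<longlonglongrightarrow> 1" "(\<lambda>m. 1 / (real m + 2)) \<longlonglongrightarrow> 0" "(\<lambda>m. real m / (real m + 2)) \<longlonglongrightarrow> 1"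
    by real_asymp+
  then have "(\<lambda>m. 2 * j * e * ((real m + 1) / (real m + 2)) - c * (2 * (1 / (real m + 2)) + g * (real m / (real m + 2))))
     \<longlonglongrightarrow> 2 * j * e * 1 - c * (2 * 0 + g * 1)"
    by (intro tendsto_intros)
  moreover have "(\<lambda>m. 2 * j * e * ((real m + 1) / (real m + 2)) - c * (2 * (1 / (real m + 2)) + g * (real m / (real m + 2))))
     = (\<lambda>m. (2 * j * e * (real m + 1) - c * (2 + real m * g)) / (real m + 2))"
    by (rule ext) (simp add: diff_divide_distrib add_divide_distrib distrib_left mult_ac)
  ultimately show ?thesis by simp
qed

lemma sets_data_law:
  "sets (data_law d SS r n m g) = sets (data_space d SS n m)"
  unfolding data_law_def data_space_def
  by (intro sets_pair_measure_cong sets_PiM_cong refl) (simp_all add: law_def partial_law_def)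

context missing_data_model
begin

definition full_root :: "(point \<Rightarrow> real) \<Rightarrow> point \<Rightarrow> real" where
  "full_root h x = sqrt (kfun (h x) / (\<integral>x. kfun (h x) \<partial>P))"

definition partial_root :: "nat set \<Rightarrow> (point \<Rightarrow> real) \<Rightarrow> point \<Rightarrow> real" where
  "partial_root S h y = (let K = biased_sample.cond d S f (\<lambda>x. kfun (h x)) in
     sqrt (K y / (\<integral>y. K y \<partial>partial_law d r S f)))"

definition data_root :: "nat \<Rightarrow> (nat set \<Rightarrow> nat) \<Rightarrow> (point \<Rightarrow> real) \<Rightarrow> data \<Rightarrow> real" where
  "data_root n m h = (\<lambda>(x, y). (\<Prod>i\<in>{1..n}. full_root h (x i)) *
     (\<Prod>S\<in>SS. \<Prod>i\<in>{1..m S}. partial_root S h (y S i)))"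

lemma sqrt_density_full:
  "h \<in> borel_measurable (Leb {1..d}) \<Longrightarrow> sqrt_density P (law d (perturbed d f h)) (full_root h)"
  unfolding full_root_def[abs_def] by (rule sqrt_density_law(1)[OF f])

lemma sqrt_density_partial:
  "h \<in> borel_measurable (Leb {1..d}) \<Longrightarrow> S \<in> SS \<Longrightarrow>
    sqrt_density (partial_law d r S f) (partial_law d r S (perturbed d f h)) (partial_root S h)"
  unfolding partial_root_def[abs_def] Let_def by (rule biased_sample.sqrt_density_partial_law[OF sample])

lemma sqrt_density_data:
  assumes h: "h \<in> borel_measurable (Leb {1..d})"
  shows "sqrt_density (data_law d SS r n m f) (data_law d SS r n m (perturbed d f h)) (data_root n m h)"
  unfolding data_law_def data_root_def
  by (intro sqrt_density_pair sqrt_density_PiM finite_SS sqrt_density_full[OF h] sqrt_density_partial[OF h]) simp_all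

lemma affinity_data:
  assumes h: "h \<in> borel_measurable (Leb {1..d})" and h': "h' \<in> borel_measurable (Leb {1..d})"
  shows "(\<integral>\<omega>. data_root n m h \<omega> * data_root n m h' \<omega> \<partial>data_law d SS r n m f)
    = (\<integral>x. full_root h x * full_root h' x \<partial>P) ^ n *
      (\<Prod>S\<in>SS. (\<integral>y. partial_root S h y * partial_root S h' y \<partial>partial_law d r S f) ^ m S)"
proof -
  note F = sqrt_density_full[OF h] and F' = sqrt_density_full[OF h']
  note G = sqrt_density_partial[OF h] and G' = sqrt_density_partial[OF h']
  have fin: "finite {1..k}" for k :: nat by simp
  note FP = sqrt_density_PiM[OF fin F] and FP' = sqrt_density_PiM[OF fin F']
  note GP = sqrt_density_PiM[OF fin G] and GP' = sqrt_density_PiM[OF fin G']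
  note GPP = sqrt_density_PiM[OF finite_SS GP] and GPP' = sqrt_density_PiM[OF finite_SS GP']
  have 1: "(\<integral>x. (\<Prod>i\<in>{1..n}. full_root h (x i)) * (\<Prod>i\<in>{1..n}. full_root h' (x i)) \<partial>PiM {1..n} (\<lambda>_. P))
     = (\<integral>x. full_root h x * full_root h' x \<partial>P) ^ n"
    by (subst affinity_PiM[OF fin F F']) simp_all
  have 2: "(\<integral>y. (\<Prod>S\<in>SS. \<Prod>i\<in>{1..m S}. partial_root S h (y S i)) * (\<Prod>S\<in>SS. \<Prod>i\<in>{1..m S}. partial_root S h' (y S i))
       \<partial>(\<Pi>\<^sub>M S\<in>SS. \<Pi>\<^sub>M i\<in>{1..m S}. partial_law d r S f))
    = (\<Prod>S\<in>SS. (\<integral>y. partial_root S h y * partial_root S h' y \<partial>partial_law d r S f) ^ m S)"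
  proof (rule trans[OF affinity_PiM[OF finite_SS]], rule GP, assumption, rule GP', assumption)
    show "(\<Prod>S\<in>SS. \<integral>y. (\<Prod>i\<in>{1..m S}. partial_root S h (y i)) * (\<Prod>i\<in>{1..m S}. partial_root S h' (y i))
         \<partial>PiM {1..m S} (\<lambda>_. partial_law d r S f))
      = (\<Prod>S\<in>SS. (\<integral>y. partial_root S h y * partial_root S h' y \<partial>partial_law d r S f) ^ m S)"
    proof (rule prod.cong[OF refl])
      fix S assume S: "S \<in> SS"
      from affinity_PiM[OF fin[of "m S"] G[OF S] G'[OF S]]
      show "(\<integral>y. (\<Prod>i\<in>{1..m S}. partial_root S h (y i)) * (\<Prod>i\<in>{1..m S}. partial_root S h' (y i))
         \<partial>PiM {1..m S} (\<lambda>_. partial_law d r S f))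
        = (\<integral>y. partial_root S h y * partial_root S h' y \<partial>partial_law d r S f) ^ m S" by simp
    qed
  qed
  show ?thesis
    unfolding data_law_def data_root_def 1[symmetric] 2[symmetric]
    by (rule affinity_pair[OF FP GPP FP' GPP']) assumption+
qed

context
  fixes u :: "nat set \<Rightarrow> point \<Rightarrow> real" and nS :: "nat set \<Rightarrow> nat \<Rightarrow> nat"
  assumes min: "is_arg_min (Lobj d SS f r lam a) (\<lambda>\<alpha>. \<alpha> \<in> Pi SS (H d f)) u"
    and nS: "\<And>S. S \<in> SS \<Longrightarrow> (\<lambda>n. real (nS S n) / real n) \<longlonglongrightarrow> lam S"
begin

definition shift :: "nat \<Rightarrow> real \<Rightarrow> point \<Rightarrow> real" where
  "shift n t = (\<lambda>x. real n powr (- 1 / 2) * t * residual u x)"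

lemma shift_measurable: "shift n t \<in> borel_measurable (Leb {1..d})"
  using residual_facts(1)[OF minimiser_Pi[OF min]] unfolding shift_def by measurable

abbreviation "base n \<equiv> data_law d SS r n (\<lambda>S. nS S n) f"
abbreviation "lroot n t \<equiv> data_root n (\<lambda>S. nS S n) (shift n t)"

text \<open>
  The exponents of the independent samples add up to the information.
\<close>

lemma affinity_data_limit:
  "(\<lambda>n. \<integral>\<omega>. lroot n s \<omega> * lroot n t \<omega> \<partial>base n) \<longlonglongrightarrow> exp (- ((s - t)\<^sup>2 * information u / 8))"
proof -
  have \<alpha>: "residual u \<in> L2 d f"
    using residual_facts[OF minimiser_Pi[OF min]] by (simp add: L2_law[OF f])
  define E where "E = (\<integral>x. (residual u x)\<^sup>2 \<partial>P)"
  have "(\<lambda>n. real n * (1 - (\<integral>x. full_root (shift n s) x * full_root (shift n t) x \<partial>P))) \<longlonglongrightarrow> (s - t)\<^sup>2 * E / 8"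
    using full_affinity_limit[OF f \<alpha>, of s t] residual_facts(4)[OF minimiser_Pi[OF min]]
    unfolding full_root_def shift_def E_def by simp
  moreover have "(\<lambda>n. real n / real n) \<longlonglongrightarrow> 1" by real_asymp
  ultimately have full: "(\<lambda>n. (\<integral>x. full_root (shift n s) x * full_root (shift n t) x \<partial>P) ^ n) \<longlonglongrightarrow> exp (- ((s - t)\<^sup>2 * E / 8))"
    using power_one_minus_tendsto_exp[where m = "\<lambda>n. n" and lam = 1] by fastforce
  have partial: "(\<lambda>n. (\<integral>y. partial_root S (shift n s) y * partial_root S (shift n t) y \<partial>partial_law d r S f) ^ nS S n)
     \<longlonglongrightarrow> exp (- ((s - t)\<^sup>2 * penalty u S / 8))" if S: "S \<in> SS" for S
  proof -
    interpret B: biased_sample d S f r by (rule sample[OF S])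
    obtain C where C: "AE y in density (Leb S) (\<lambda>y. ennreal (marginal d S f y)). B.rbar y \<le> C"
      using r_bounded[OF S] by blast
    let ?v = "(\<integral>y. (B.cond (residual u) y)\<^sup>2 \<partial>B.Q) - (\<integral>y. B.cond (residual u) y \<partial>B.Q)\<^sup>2"
    have "(\<lambda>n. real n * (1 - (\<integral>y. partial_root S (shift n s) y * partial_root S (shift n t) y \<partial>B.Q))) \<longlonglongrightarrow> (s - t)\<^sup>2 * ?v / 8"
      using B.partial_affinity_limit[OF \<alpha> C, of s t] unfolding partial_root_def Let_def shift_def .
    from power_one_minus_tendsto_exp[OF this nS[OF S]]
    have "(\<lambda>n. (\<integral>y. partial_root S (shift n s) y * partial_root S (shift n t) y \<partial>B.Q) ^ nS S n)
       \<longlonglongrightarrow> exp (- (lam S * ((s - t)\<^sup>2 * ?v / 8)))" by simp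
    also have "lam S * ((s - t)\<^sup>2 * ?v / 8) = (s - t)\<^sup>2 * penalty u S / 8"
      unfolding partial_information(1)[OF min S, symmetric] by simp
    finally show ?thesis .
  qed
  have "(\<lambda>n. \<integral>\<omega>. lroot n s \<omega> * lroot n t \<omega> \<partial>base n)
     \<longlonglongrightarrow> exp (- ((s - t)\<^sup>2 * E / 8)) * (\<Prod>S\<in>SS. exp (- ((s - t)\<^sup>2 * penalty u S / 8)))"
    unfolding affinity_data[OF shift_measurable shift_measurable]
    by (intro tendsto_mult full tendsto_prod partial)
  also have "exp (- ((s - t)\<^sup>2 * E / 8)) * (\<Prod>S\<in>SS. exp (- ((s - t)\<^sup>2 * penalty u S / 8))) = exp (- ((s - t)\<^sup>2 * information u / 8))"
    unfolding information_def[OF min] E_def exp_sum[OF finite_SS, symmetric] exp_add[symmetric] sum_negf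
    by (simp add: sum_divide_distrib[symmetric] sum_distrib_left[symmetric] distrib_left add_divide_distrib)
  finally show ?thesis .
qed

abbreviation "risk est n t \<equiv> scaled_risk d SS r a n (\<lambda>S. nS S n) (est n) (perturbed d f (shift n t))"

text \<open>
  The discrete van Trees inequality for the observed data with multiplier \<open>1 / \<delta>\<close>, in the limit
  of growing sample sizes.
\<close>

lemma grid_risk_bound:
  fixes est :: "nat \<Rightarrow> data \<Rightarrow> real" and m :: nat and \<delta> :: real
  assumes est: "\<And>n. n \<ge> 1 \<Longrightarrow> est n \<in> borel_measurable (data_space d SS n (\<lambda>S. nS S n))"
    and \<delta>: "0 < \<delta>"
  defines "I \<equiv> (\<lambda>j. \<delta> * real j) ` {..Suc m}"
  shows "ennreal ((2 * information u * exp (- (\<delta>\<^sup>2 * information u / 8)) * (real m + 1)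
            - (1 / \<delta>)\<^sup>2 * (2 + real m * (2 - 2 * exp (- (\<delta>\<^sup>2 * information u / 2))))) / (real m + 2))
     \<le> liminf (\<lambda>n. Max (risk est n ` I))"
proof -
  define \<psi> where "\<psi> n j = theta d a (perturbed d f (shift n (\<delta> * real j)))" for n j
  define B where "B n i j = (\<integral>\<omega>. lroot n (\<delta> * real i) \<omega> * lroot n (\<delta> * real j) \<omega> \<partial>base n)" for n i j
  define b where "b n = (2 * (1 / \<delta>) * sqrt (real n) * (\<Sum>j\<le>m. (\<psi> n (Suc j) - \<psi> n j) * B n j (Suc j))
            - (1 / \<delta>)\<^sup>2 * (2 + (\<Sum>j<m. 2 - 2 * B n j (Suc (Suc j))))) / (real m + 2)" for n
  have low: "ennreal (b n) \<le> Max (risk est n ` I)" if n: "n \<ge> 1" for n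
  proof -
    note sd = sqrt_density_data[OF shift_measurable, of n "\<lambda>S. nS S n" n]
    have dens: "data_law d SS r n (\<lambda>S. nS S n) (perturbed d f (shift n t)) = density (base n) (\<lambda>\<omega>. ennreal ((lroot n t \<omega>)\<^sup>2))" for t
      using sd[of t] by (simp add: sqrt_density_def)
    have "est n \<in> borel_measurable (base n)"
      using est[OF n] measurable_cong_sets[OF sets_data_law refl] by blast
    then have "ennreal (b n) \<le> Max ((\<lambda>j. \<integral>\<^sup>+\<omega>. ennreal ((sqrt (real n))\<^sup>2 * (est n \<omega> - \<psi> n j)\<^sup>2)
        \<partial>density (base n) (\<lambda>\<omega>. ennreal ((lroot n (\<delta> * real j) \<omega>)\<^sup>2))) ` {..Suc m})"
      unfolding b_def B_def using sd sqrt_density_integrable[OF sd]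
      by (intro grid_van_trees) (simp_all add: sqrt_density_def)
    also have "\<dots> = Max (risk est n ` I)"
      unfolding I_def image_image scaled_risk_def dens \<psi>_def by simp
    finally show ?thesis .
  qed
  have limB: "(\<lambda>n. B n i j) \<longlonglongrightarrow> exp (- ((\<delta> * real i - \<delta> * real j)\<^sup>2 * information u / 8))" for i j
    unfolding B_def by (rule affinity_data_limit)
  have limpsi: "(\<lambda>n. sqrt (real n) * (\<psi> n j - theta d a f)) \<longlonglongrightarrow> \<delta> * real j * information u" for j
    using theta_local_limit[OF f _ a_L2 residual_facts(4)[OF minimiser_Pi[OF min]], of "\<delta> * real j"]
      residual_facts[OF minimiser_Pi[OF min]]
    unfolding \<psi>_def shift_def derivative_eq_information[OF min] by (simp add: L2_law[OF f])
  have limdiff: "(\<lambda>n. sqrt (real n) * (\<psi> n (Suc j) - \<psi> n j)) \<longlonglongrightarrow> \<delta> * information u" for j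
    using tendsto_diff[OF limpsi[of "Suc j"] limpsi[of j]] by (simp add: algebra_simps)
  have "b = (\<lambda>n. (2 * (1 / \<delta>) * (\<Sum>j\<le>m. sqrt (real n) * (\<psi> n (Suc j) - \<psi> n j) * B n j (Suc j))
            - (1 / \<delta>)\<^sup>2 * (2 + (\<Sum>j<m. 2 - 2 * B n j (Suc (Suc j))))) / (real m + 2))"
    by (rule ext) (simp add: b_def sum_distrib_left mult.assoc)
  also have "\<dots> \<longlonglongrightarrow> (2 * (1 / \<delta>) * (\<Sum>j\<le>m. \<delta> * information u * exp (- ((\<delta> * real j - \<delta> * real (Suc j))\<^sup>2 * information u / 8)))
            - (1 / \<delta>)\<^sup>2 * (2 + (\<Sum>j<m. 2 - 2 * exp (- ((\<delta> * real j - \<delta> * real (Suc (Suc j)))\<^sup>2 * information u / 8))))) / (real m + 2)"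
    by (intro tendsto_intros limdiff limB) simp
  also have "(2 * (1 / \<delta>) * (\<Sum>j\<le>m. \<delta> * information u * exp (- ((\<delta> * real j - \<delta> * real (Suc j))\<^sup>2 * information u / 8)))
            - (1 / \<delta>)\<^sup>2 * (2 + (\<Sum>j<m. 2 - 2 * exp (- ((\<delta> * real j - \<delta> * real (Suc (Suc j)))\<^sup>2 * information u / 8))))) / (real m + 2)
     = (2 * information u * exp (- (\<delta>\<^sup>2 * information u / 8)) * (real m + 1)
            - (1 / \<delta>)\<^sup>2 * (2 + real m * (2 - 2 * exp (- (\<delta>\<^sup>2 * information u / 2))))) / (real m + 2)"
  proof -
    have "(\<delta> * real j - \<delta> * real (Suc j))\<^sup>2 = \<delta>\<^sup>2" "(\<delta> * real j - \<delta> * real (Suc (Suc j)))\<^sup>2 = 4 * \<delta>\<^sup>2" for j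
      by (simp_all add: power2_eq_square algebra_simps)
    then show ?thesis using \<delta> by (simp add: mult_ac)
  qed
  finally have lim: "b \<longlonglongrightarrow> (2 * information u * exp (- (\<delta>\<^sup>2 * information u / 8)) * (real m + 1)
            - (1 / \<delta>)\<^sup>2 * (2 + real m * (2 - 2 * exp (- (\<delta>\<^sup>2 * information u / 2))))) / (real m + 2)" .
  have "liminf (\<lambda>n. ennreal (b n)) \<le> liminf (\<lambda>n. Max (risk est n ` I))"
    by (rule Liminf_mono, rule eventually_mono[OF eventually_ge_at_top[of 1] low])
  moreover have "liminf (\<lambda>n. ennreal (b n)) = ennreal ((2 * information u * exp (- (\<delta>\<^sup>2 * information u / 8)) * (real m + 1)
            - (1 / \<delta>)\<^sup>2 * (2 + real m * (2 - 2 * exp (- (\<delta>\<^sup>2 * information u / 2))))) / (real m + 2))"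
    by (intro lim_imp_Liminf tendsto_ennrealI lim) simp
  ultimately show ?thesis by simp
qed

text \<open>
  In the grid bound the number of points is sent to infinity first, and then the spacing \<open>1 / (k + 1)\<close>
  to 0.
\<close>

lemma local_minimax:
  fixes est :: "nat \<Rightarrow> data \<Rightarrow> real"
  assumes est: "\<And>n. n \<ge> 1 \<Longrightarrow> est n \<in> borel_measurable (data_space d SS n (\<lambda>S. nS S n))"
  shows "ennreal (information u) \<le> (\<Squnion>I\<in>{I :: real set. finite I \<and> I \<noteq> {}}. liminf (\<lambda>n. Max (risk est n ` I)))"
    (is "_ \<le> ?sup")
proof (cases "information u = 0")
  case False
  then have pos: "0 < information u" using information_nonneg[OF min] by simp
  have bound: "ennreal (2 * information u * exp (- (\<delta>\<^sup>2 * information u / 8)) - (1 / \<delta>)\<^sup>2 * (2 - 2 * exp (- (\<delta>\<^sup>2 * information u / 2)))) \<le> ?sup"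
    if \<delta>: "0 < \<delta>" for \<delta>
  proof (rule LIMSEQ_le_const2[OF tendsto_ennrealI[OF grid_bound_limit_points]], intro exI allI impI)
    fix m :: nat
    note grid_risk_bound[OF est \<delta>, of m]
    also have "liminf (\<lambda>n. Max (risk est n ` (\<lambda>j. \<delta> * real j) ` {..Suc m})) \<le> ?sup"
      by (rule SUP_upper) simp
    finally show "ennreal ((2 * information u * exp (- (\<delta>\<^sup>2 * information u / 8)) * (real m + 1)
            - (1 / \<delta>)\<^sup>2 * (2 + real m * (2 - 2 * exp (- (\<delta>\<^sup>2 * information u / 2))))) / (real m + 2)) \<le> ?sup" .
  qed
  have "((\<lambda>k. 2 * j * exp (- ((1 / (real k + 1))\<^sup>2 * j / 8)) - (1 / (1 / (real k + 1)))\<^sup>2 * (2 - 2 * exp (- ((1 / (real k + 1))\<^sup>2 * j / 2)))) \<longlonglongrightarrow> j)"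
    if "0 < j" for j :: real
    using that by real_asymp
  from tendsto_ennrealI[OF this[OF pos]] show ?thesis
    by (rule LIMSEQ_le_const2) (intro exI allI impI bound, simp)
qed simp

lemmas local_minimax_explicit = local_minimax[unfolded shift_def residual_def]

end

end

theorem theorem8:
  fixes d :: nat
    and f a :: "point \<Rightarrow> real"
    and SS :: "nat set set"
    and r :: "nat set \<Rightarrow> point \<Rightarrow> real"
    and nS :: "nat set \<Rightarrow> nat \<Rightarrow> nat"
    and lam :: "nat set \<Rightarrow> real"
    and alphaS :: "nat set \<Rightarrow> point \<Rightarrow> real"
    and alpha :: "point \<Rightarrow> real"
    and est :: "nat \<Rightarrow> data \<Rightarrow> real"
  assumes "d \<ge> 2"
    and "prob_density d f"
    and "SS \<subseteq> Pow {1..d} - {{1..d}}"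
    and "\<And>S. S \<in> SS \<Longrightarrow> r S \<in> borel_measurable (Leb S)"
    and "\<And>S y. S \<in> SS \<Longrightarrow> y \<in> space (Leb S) \<Longrightarrow> r S y > 0"
    and "\<And>S. S \<in> SS \<Longrightarrow> integrable (Leb S) (\<lambda>y. r S y * marginal d S f y)"
    and "\<And>S. S \<in> SS \<Longrightarrow>
           \<exists>C. AE y in density (Leb S) (\<lambda>y. ennreal (marginal d S f y)). normalised d r S f y \<le> C"
    and "a \<in> L2 d f"
    and "\<And>S n. S \<in> SS \<Longrightarrow> n \<ge> 1 \<Longrightarrow> nS S n \<ge> 1"
    and "\<And>S. S \<in> SS \<Longrightarrow> lam S > 0"
    and "\<And>S. S \<in> SS \<Longrightarrow> (\<lambda>n. real (nS S n) / real n) \<longlonglongrightarrow> lam S"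
    and "is_arg_min (Lobj d SS f r lam a) (\<lambda>\<alpha>. \<alpha> \<in> Pi SS (H d f)) alphaS"
    and "alpha = (\<lambda>x. a x - theta d a f - (\<Sum>S\<in>SS. alphaS S x))"
    and "\<And>n. n \<ge> 1 \<Longrightarrow> est n \<in> borel_measurable (data_space d SS n (\<lambda>S. nS S n))"
  shows "(\<Squnion>I\<in>{I :: real set. finite I \<and> I \<noteq> {}}.
            liminf (\<lambda>n. Max ((\<lambda>t. scaled_risk d SS r a n (\<lambda>S. nS S n) (est n)
              (perturbed d f (\<lambda>x. real n powr (- 1 / 2) * t * alpha x))) ` I)))
         \<ge> (\<Sqinter>\<alpha>\<in>Pi SS (H d f). Lobj d SS f r lam a \<alpha>)"
proof -
  interpret missing_data_model d f a SS r lam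
    using assms(2-8,10) by unfold_locales auto
  note min = assms(12) and nS = assms(11)
  have "(\<Sqinter>\<alpha>\<in>Pi SS (H d f). Lobj d SS f r lam a \<alpha>) \<le> Lobj d SS f r lam a alphaS"
    by (rule INF_lower) (rule minimiser_Pi[OF min])
  also have "\<dots> = ennreal (information alphaS)"
    by (simp add: minimum_value[OF min] information_def[OF min])
  also have "\<dots> \<le> (\<Squnion>I\<in>{I :: real set. finite I \<and> I \<noteq> {}}.
            liminf (\<lambda>n. Max ((\<lambda>t. scaled_risk d SS r a n (\<lambda>S. nS S n) (est n)
              (perturbed d f (\<lambda>x. real n powr (- 1 / 2) * t * alpha x))) ` I)))"
    unfolding assms(13) by (rule local_minimax_explicit[OF min nS assms(14)])
  finally show ?thesis .
qed

end
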